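(* Let $d,b\ge 1$ be integers, $\eta>0$, and let $(a_i,q_i)_{i\ge1}$ be i.i.d. random variables in $\mathbb{R}^d\times\mathbb{R}$ such that $a_1\sim \mathrm{N}(0,\sigma^2 I_d)$ with $\sigma^2>0$, and $q_1$ has a continuous density with respect to the Lebesgue measure on $\mathbb{R}$ and all its moments are finite. Let $\mathbf{A}_1=b^{-1}\sum_{i=1}^b a_ia_i^\top$ and assume $\mathbb{E}[\log\|I_d-\eta\mathbf{A}_1\|]<0$. Let $\alpha>0$ be the unique number with $\mathbb{E}[\|I_d-\eta\mathbf{A}_1\|^\alpha]=1$, and assume $\alpha>1$ and $\alpha\notin\mathbb{N}$. Let $\pi$ be the stationary distribution of the online SGD chain $(X_k)_{k\ge0}$. Let $p,q>0$ satisfy $1/p+1/q=1$, $p>d/2$ and $q<\alpha$. Let $n\ge1$ (with $n\ge b$) and let $\epsilon_n\in[0,1]$ be the probability (over the dataset $\{(a_i,q_i)\}_{i=1}^n$) that the offline SGD chain $(X_k^{(n)})_{k\ge0}$ fails to be Wasserstein-1 ergodic with a stationary distribution $\pi^{(n)}$ having finite $q$-th moment. Then, with probability (over the dataset) at least $1-\epsilon_n$, $$\mathbf{W}_1(\pi,\pi^{(n)})\le c_0\,\frac{\eta}{1-\delta_A}\,\mathbf{W}_p\big(\mu_{\mathbf{A},\mathbf{b}},\mu^{(n)}_{\mathbf{A},\mathbf{b}}\big),$$ where $c_0=(\mathbb{E}[\|X_0^{(n)}\|^q])^{1/q}+1$ with $X_0^{(n)}\sim\pi^{(n)}$ (expectation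 conditional on the dataset), and $\delta_A=\mathbb{E}[\|I_d-\eta\mathbf{A}_1\|]$.
   Context: $\|\cdot\|$ is the Euclidean norm of vectors and the spectral norm of matrices. $b$ is the batch size, $\eta$ the step size. (The real-valued data components $q_i$ are unrelated to the exponent $q$.) Online SGD (quadratic loss): $X_{k+1}=(I_d-\eta\mathbf{A}_{k+1})X_k+\eta\mathbf{b}_{k+1}$, where $\Omega_k=\{b(k-1)+1,\dots,bk\}$, $\mathbf{A}_k=b^{-1}\sum_{i\in\Omega_k}a_ia_i^\top$, $\mathbf{b}_k=b^{-1}\sum_{i\in\Omega_k}a_iq_i$. Under the stated hypotheses it is known (a cited earlier result, which may be taken as given) that a unique $\alpha>0$ with $\mathbb{E}[\|I_d-\eta\mathbf{A}_1\|^\alpha]=1$ exists and that $(X_k)$ converges in distribution to a unique stationary distribution $\pi$. Offline SGD with $n\ge b$ data points: given the dataset $\{(a_i,q_i)\}_{i=1}^n$, $X^{(n)}_{k+1}=(I_d-\eta\mathbf{A}^{(n)}_{k+1})X^{(n)}_k+\eta\mathbf{b}^{(n)}_{k+1}$, where $\mathbf{A}^{(n)}_k=b^{-1}\sum_{i\in\Omega^{(n)}_k}a_ia_i^\top$, $\mathbf{b}^{(n)}_k=b^{-1}\sum_{i\in\Omega^{(n)}_k}a_iq_i$ and the $\Omega_k^{(n)}$, $k\ge1$, are independent and uniformly distributed over the subsets of $\{1,\dots,n\}$ of cardinality $b$. $\mu_{\mathbf{A},\mathbf{b}}$ is the law on $\mathbb{R}^{d\times d}\times\mathbb{R}^d$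 of $(b^{-1}\sum_{j=1}^b a_ja_j^\top,\;b^{-1}\sum_{j=1}^b a_jq_j)$. $\mu^{(n)}_{\mathbf{A},\mathbf{b}}=\binom{n}{b}^{-1}\sum_{S}\delta_{(b^{-1}\sum_{j\in S}a_ja_j^\top,\;b^{-1}\sum_{j\in S}a_jq_j)}$, the sum over all $S\subset\{1,\dots,n\}$ with $|S|=b$; this is the conditional law of $(\mathbf{A}^{(n)}_k,\mathbf{b}^{(n)}_k)$ given the dataset. Wasserstein-$p$ distance ($p\ge1$): $\mathbf{W}_p(\mu,\nu)=\inf_\gamma\left(\int\|x-y\|^p\,d\gamma(x,y)\right)^{1/p}$, the infimum over couplings $\gamma$ of $\mu,\nu$; on $\mathbb{R}^{d\times d}\times\mathbb{R}^d$ the norm is $\|(\mathbf{A},\mathbf{b})\|=(\|\mathbf{A}\|^2+\|\mathbf{b}\|^2)^{1/2}$. A discrete-time Markov chain $(Y_k)_{k\ge0}$ is (Wasserstein-1) ergodic if it admits a stationary distribution $\pi_Y$ with $\lim_{k\to\infty}\mathbf{W}_1(\mathcal{L}(Y_k),\pi_Y)=0$, where $\mathcal{L}(Y_k)$ is the law of $Y_k$. For the offline chain this is understood conditionally on the dataset. *)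

theory Defs
  imports "HOL-Probability.Probability"
begin

(* The norm on the type real^'d^'d is the Frobenius norm, hence the separate operator norm. *)
definition spectral_norm :: "real^'d^'d \<Rightarrow> real" where
  "spectral_norm A = onorm (\<lambda>x. A *v x)"

definition pair_norm :: "(real^'d^'d) \<times> (real^'d) \<Rightarrow> real" where
  "pair_norm z = sqrt ((spectral_norm (fst z))\<^sup>2 + (norm (snd z))\<^sup>2)"

definition outer_square :: "real^'d \<Rightarrow> real^'d^'d" where
  "outer_square v = (\<chi> i j. v $ i * v $ j)"


section \<open>Wasserstein distances\<close>

definition couplings ::
  "'x::topological_space measure \<Rightarrow> 'x measure \<Rightarrow> ('x \<times> 'x) measure set" where
  "couplings \<mu> \<nu> = {\<gamma>. prob_space \<gamma> \<and> sets \<gamma> = sets (borel \<Otimes>\<^sub>M borel) \<and>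
     distr \<gamma> borel fst = \<mu> \<and> distr \<gamma> borel snd = \<nu>}"

definition ennreal_root :: "real \<Rightarrow> ennreal \<Rightarrow> ennreal" where
  "ennreal_root p t = (if t = \<infinity> then \<infinity> else ennreal (enn2real t powr (1 / p)))"

(* The norm is an argument, because the one on pairs is not that of the product type.
   The value is extended real, so that distances of laws without moments are infinite. *)
definition wasserstein ::
  "real \<Rightarrow> ('x \<Rightarrow> real) \<Rightarrow> 'x::{topological_space,minus} measure \<Rightarrow> 'x measure \<Rightarrow> ennreal" where
  "wasserstein p nrm \<mu> \<nu> =
     (INF \<gamma> \<in> couplings \<mu> \<nu>. ennreal_root p (\<integral>\<^sup>+ z. ennreal (nrm (fst z - snd z) powr p) \<partial>\<gamma>))"


section \<open>Stochastic gradient descent for the quadratic loss\<close>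

(* A data set is given by the two sequences a and y, indexed from 1. *)

definition batch_matrix :: "nat \<Rightarrow> (nat \<Rightarrow> real^'d) \<Rightarrow> nat set \<Rightarrow> real^'d^'d" where
  "batch_matrix b a S = (1 / real b) *\<^sub>R (\<Sum>i\<in>S. outer_square (a i))"

definition batch_vector :: "nat \<Rightarrow> (nat \<Rightarrow> real^'d) \<Rightarrow> (nat \<Rightarrow> real) \<Rightarrow> nat set \<Rightarrow> real^'d" where
  "batch_vector b a y S = (1 / real b) *\<^sub>R (\<Sum>i\<in>S. y i *\<^sub>R a i)"

definition batch_pair ::
  "nat \<Rightarrow> (nat \<Rightarrow> real^'d) \<Rightarrow> (nat \<Rightarrow> real) \<Rightarrow> nat set \<Rightarrow> (real^'d^'d) \<times> (real^'d)" where
  "batch_pair b a y S = (batch_matrix b a S, batch_vector b a y S)"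

(* SGD with step size eta, whose k-th step (k >= 1) uses the batch Om k, started at x. *)
primrec sgd ::
  "real \<Rightarrow> nat \<Rightarrow> (nat \<Rightarrow> real^'d) \<Rightarrow> (nat \<Rightarrow> real) \<Rightarrow> (nat \<Rightarrow> nat set) \<Rightarrow> real^'d \<Rightarrow> nat \<Rightarrow> real^'d"
where
  "sgd \<eta> b a y Om x 0 = x"
| "sgd \<eta> b a y Om x (Suc k) =
     (mat 1 - \<eta> *\<^sub>R batch_matrix b a (Om (Suc k))) *v sgd \<eta> b a y Om x k
       + \<eta> *\<^sub>R batch_vector b a y (Om (Suc k))"

definition online_batch :: "nat \<Rightarrow> nat \<Rightarrow> nat set" where
  "online_batch b k = {b * (k - 1) + 1 .. b * k}"

definition batches :: "nat \<Rightarrow> nat \<Rightarrow> nat set set" where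
  "batches n b = {S. S \<subseteq> {1..n} \<and> card S = b}"


(* indep_var of the library requires both random variables to have the same type. *)
definition indep_of_each_other ::
  "'s measure \<Rightarrow> 'x measure \<Rightarrow> ('s \<Rightarrow> 'x) \<Rightarrow> 'z measure \<Rightarrow> ('s \<Rightarrow> 'z) \<Rightarrow> bool" where
  "indep_of_each_other N S X T Z \<longleftrightarrow> X \<in> measurable N S \<and> Z \<in> measurable N T \<and>
     prob_space.indep_set N (sets (vimage_algebra (space N) X S)) (sets (vimage_algebra (space N) Z T))"


section \<open>Stationarity and ergodicity\<close>

definition stationary_distribution ::
  "('x::topological_space \<Rightarrow> 'x measure) \<Rightarrow> 'x measure \<Rightarrow> bool" where
  "stationary_distribution K \<pi> \<longleftrightarrow> prob_space \<pi> \<and> sets \<pi> = sets borel \<and> \<pi> \<bind> K = \<pi>"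

(* Y is a chain with transition kernel K on the probability space N. *)
definition W1_ergodic_with ::
  "('x::real_normed_vector \<Rightarrow> 'x measure) \<Rightarrow> 's measure \<Rightarrow> (nat \<Rightarrow> 's \<Rightarrow> 'x) \<Rightarrow> 'x measure \<Rightarrow> bool"
where
  "W1_ergodic_with K N Y \<pi> \<longleftrightarrow> stationary_distribution K \<pi> \<and>
     (\<lambda>k. wasserstein 1 norm (distr N borel (Y k)) \<pi>) \<longlonglongrightarrow> 0"

definition finite_moment :: "real \<Rightarrow> 'x::real_normed_vector measure \<Rightarrow> bool" where
  "finite_moment r \<pi> \<longleftrightarrow> integrable \<pi> (\<lambda>x. norm x powr r)"

(* The transition kernels are the laws of the first iterate of the chain started at x.
   Online, the randomness is the data (on M). *)
definition online_kernel ::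
  "real \<Rightarrow> nat \<Rightarrow> 'w measure \<Rightarrow> (nat \<Rightarrow> 'w \<Rightarrow> real^'d) \<Rightarrow> (nat \<Rightarrow> 'w \<Rightarrow> real) \<Rightarrow> real^'d \<Rightarrow> (real^'d) measure"
where
  "online_kernel \<eta> b M a y x =
     distr M borel (\<lambda>\<omega>. sgd \<eta> b (\<lambda>i. a i \<omega>) (\<lambda>i. y i \<omega>) (online_batch b) x 1)"

(* Offline, the data set (a, y) is frozen and the randomness is the choice of batches (on N). *)
definition offline_kernel ::
  "real \<Rightarrow> nat \<Rightarrow> (nat \<Rightarrow> real^'d) \<Rightarrow> (nat \<Rightarrow> real) \<Rightarrow> 's measure \<Rightarrow> (nat \<Rightarrow> 's \<Rightarrow> nat set) \<Rightarrow> real^'d \<Rightarrow> (real^'d) measure"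
where
  "offline_kernel \<eta> b a y N Om x =
     distr N borel (\<lambda>s. sgd \<eta> b a y (\<lambda>k. Om k s) x 1)"

definition offline_ergodic_with ::
  "real \<Rightarrow> nat \<Rightarrow> (nat \<Rightarrow> real^'d) \<Rightarrow> (nat \<Rightarrow> real) \<Rightarrow> 's measure \<Rightarrow> (nat \<Rightarrow> 's \<Rightarrow> nat set) \<Rightarrow>
     ('s \<Rightarrow> real^'d) \<Rightarrow> (real^'d) measure \<Rightarrow> bool"
where
  "offline_ergodic_with \<eta> b a y N Om X0 \<pi> \<longleftrightarrow>
     W1_ergodic_with (offline_kernel \<eta> b a y N Om) N
       (\<lambda>k s. sgd \<eta> b a y (\<lambda>k. Om k s) (X0 s) k) \<pi>"


section \<open>Laws of the data matrices and vectors\<close>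

definition population_law ::
  "nat \<Rightarrow> 'w measure \<Rightarrow> (nat \<Rightarrow> 'w \<Rightarrow> real^'d) \<Rightarrow> (nat \<Rightarrow> 'w \<Rightarrow> real) \<Rightarrow> ((real^'d^'d) \<times> (real^'d)) measure"
where
  "population_law b M a y =
     distr M borel (\<lambda>\<omega>. batch_pair b (\<lambda>i. a i \<omega>) (\<lambda>i. y i \<omega>) {1..b})"

definition empirical_law ::
  "nat \<Rightarrow> nat \<Rightarrow> (nat \<Rightarrow> real^'d) \<Rightarrow> (nat \<Rightarrow> real) \<Rightarrow> ((real^'d^'d) \<times> (real^'d)) measure"
where
  "empirical_law n b a y =
     distr (uniform_count_measure (batches n b)) borel (batch_pair b a y)"

end

theory Submission
  imports Defs
begin

text \<open>Let \<open>\<gamma>\<close> couple \<open>\<pi>\<close> and \<open>\<pi>\<^sub>n\<close>, and let \<open>\<kappa>\<close> couple the laws of \<open>(A, b)\<close> and \<open>(A', b')\<close>. One SGD step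
  with \<open>(X, Y) \<sim> \<gamma>\<close> independent of \<open>((A, b), (A', b')) \<sim> \<kappa>\<close> preserves both stationary laws, so
  \<open>W\<^sub>1(\<pi>, \<pi>\<^sub>n) \<le> \<delta>\<^sub>A E |X - Y| + \<eta> (E |Y| E |A - A'| + E |b - b'|)\<close>.
  The last term is at most \<open>\<eta> c\<^sub>0\<close> times the \<open>p\<close>-cost of \<open>\<kappa>\<close>. Taking infima over \<open>\<gamma>\<close> and \<open>\<kappa>\<close>
  and solving for \<open>W\<^sub>1(\<pi>, \<pi>\<^sub>n)\<close> gives the bound; this needs \<open>\<delta>\<^sub>A < 1\<close>, which is strict Jensen between
  the exponents 1 and \<open>\<alpha>\<close>, and \<open>W\<^sub>1(\<pi>, \<pi>\<^sub>n) < \<infinity>\<close>, which is finiteness of the first moments.\<close>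

section \<open>Spectral norm\<close>

lemma spectral_norm_nonneg [simp]: "0 \<le> spectral_norm A"
  unfolding spectral_norm_def by (rule onorm_pos_le) simp

lemma norm_matrix_vector_le: "norm (A *v x) \<le> spectral_norm A * norm x"
  unfolding spectral_norm_def by (rule onorm) simp

lemma spectral_norm_triangle: "spectral_norm (A + B) \<le> spectral_norm A + spectral_norm B"
  unfolding spectral_norm_def matrix_vector_mult_add_rdistrib
  by (rule onorm_triangle) simp_all

lemma spectral_norm_scaleR: "spectral_norm (c *\<^sub>R A) = \<bar>c\<bar> * spectral_norm A"
proof -
  have "(\<lambda>x. (c *\<^sub>R A) *v x) = (\<lambda>x. c *\<^sub>R (A *v x))"
    by (simp add: scaleR_matrix_vector_assoc)
  then show ?thesis
    unfolding spectral_norm_def by (simp add: onorm_scaleR)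
qed

lemma spectral_norm_minus_commute: "spectral_norm (A - B) = spectral_norm (B - A)"
  using spectral_norm_scaleR[of "-1" "A - B"] by simp

lemma component_le_spectral_norm: "\<bar>A $ i $ j\<bar> \<le> spectral_norm A"
  unfolding spectral_norm_def by (rule matrix_component_le_onorm)

lemma spectral_norm_le:
  fixes A :: "real^'d^'d"
  shows "spectral_norm A \<le> (\<Sum>i\<in>UNIV. \<Sum>j\<in>UNIV. \<bar>A $ i $ j\<bar>)"
  unfolding spectral_norm_def by (rule onorm_le_matrix_component_sum)

text \<open>The reverse triangle inequality bounds the difference of two spectral norms by the sum
  of the absolute entries of \<open>A - B\<close>, which vanishes as \<open>A\<close> tends to
  \<open>B\<close> entrywise. Borel measurability of all costs below rests on this.\<close>

lemma continuous_on_spectral_norm: "continuous_on UNIV (spectral_norm :: real^'d^'d \<Rightarrow> real)"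
proof -
  have "(spectral_norm \<longlongrightarrow> spectral_norm B) (at B)" for B :: "real^'d^'d"
  proof -
    have lip: "\<bar>spectral_norm A - spectral_norm B\<bar> \<le> (\<Sum>i\<in>UNIV. \<Sum>j\<in>UNIV. \<bar>(A - B) $ i $ j\<bar>)" for A
      using spectral_norm_triangle[of "A - B" B] spectral_norm_triangle[of "B - A" A]
        spectral_norm_le[of "A - B"] spectral_norm_minus_commute[of A B]
      unfolding diff_add_cancel abs_le_iff by linarith
    have "((\<lambda>A. \<Sum>i\<in>UNIV. \<Sum>j\<in>UNIV. \<bar>(A - B) $ i $ j\<bar>) \<longlongrightarrow> (\<Sum>i\<in>UNIV. \<Sum>j\<in>UNIV. \<bar>(B - B) $ i $ j\<bar>)) (at B)"
      by (intro tendsto_sum tendsto_rabs tendsto_vec_nth tendsto_diff tendsto_ident_at tendsto_const)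
    then have lim: "((\<lambda>A. \<Sum>i\<in>UNIV. \<Sum>j\<in>UNIV. \<bar>(A - B) $ i $ j\<bar>) \<longlongrightarrow> 0) (at B)"
      by simp
    have "((\<lambda>A. spectral_norm A - spectral_norm B) \<longlongrightarrow> 0) (at B)"
      by (rule Lim_null_comparison[OF always_eventually lim]) (use lip in \<open>simp only: real_norm_def, blast\<close>)
    then show ?thesis by (rule LIM_zero_cancel)
  qed
  then show ?thesis unfolding continuous_on_def by simp
qed

lemma spectral_norm_measurable [measurable]: "spectral_norm \<in> borel_measurable borel"
  by (rule borel_measurable_continuous_onI[OF continuous_on_spectral_norm])

section \<open>The norm on pairs of a matrix and a vector\<close>

lemma continuous_on_pair_norm: "continuous_on UNIV (pair_norm :: (real^'d^'d) \<times> (real^'d) \<Rightarrow> real)"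
  unfolding pair_norm_def
  by (intro continuous_intros continuous_on_compose2[OF continuous_on_spectral_norm]) auto

lemma pair_norm_measurable [measurable]:
  "(pair_norm :: (real^'d^'d) \<times> (real^'d) \<Rightarrow> real) \<in> borel_measurable borel"
  by (rule borel_measurable_continuous_onI[OF continuous_on_pair_norm])

lemma spectral_norm_le_pair_norm: "spectral_norm (fst z) \<le> pair_norm z"
  unfolding pair_norm_def by (rule real_le_rsqrt) simp

lemma norm_le_pair_norm: "norm (snd z) \<le> pair_norm z"
  unfolding pair_norm_def by (rule real_le_rsqrt) simp

lemma pair_norm_nonneg: "0 \<le> pair_norm z"
  unfolding pair_norm_def by simp

section \<open>Moment inequalities\<close>

text \<open>Young's inequality for the product of \<open>x\<close> and 1, with exponents
  \<open>r\<close> and its conjugate. The strict form, with equality only at 1, is what later makes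
  Jensen's inequality strict.\<close>

lemma powr_young:
  fixes x r :: real
  assumes "0 \<le> x" "1 < r"
  shows "x \<le> x powr r / r + (1 - 1 / r)"
    and "x \<noteq> 1 \<Longrightarrow> x < x powr r / r + (1 - 1 / r)"
proof -
  have strict: "x < x powr r / r + (1 - 1 / r)" if ne: "x \<noteq> 1"
  proof (cases "x = 0")
    case False
    \<comment> \<open>\<open>t\<close> is the mean of \<open>x powr r\<close> and 1 with weights
      \<open>1 / r\<close> and \<open>1 - 1 / r\<close>. Concavity of \<open>ln\<close> is derived
      from its tangent bound at the two points divided by \<open>t\<close>; the weighted tangents
      then sum to \<open>t / t - 1 = 0\<close>.\<close>
    define t where "t = x powr r / r + (1 - 1 / r)"
    have x: "x > 0" using False assms by simp
    have r: "1 / r > 0" "1 - 1 / r > 0" using assms by auto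
    have t: "t > 0" using x assms unfolding t_def by (intro add_pos_pos) auto
    have l1: "ln (x powr r / t) \<le> x powr r / t - 1" using x t by (intro ln_le_minus_one) simp
    have l2: "ln (1 / t) \<le> 1 / t - 1" using t by (intro ln_le_minus_one) simp
    \<comment> \<open>Equality in both tangent bounds forces both arguments to be 1, hence
      \<open>t = 1\<close> and \<open>x powr r = 1\<close>, which leaves only
      \<open>x = 1\<close>.\<close>
    have strict: "ln (x powr r / t) \<noteq> x powr r / t - 1 \<or> ln (1 / t) \<noteq> 1 / t - 1"
    proof (rule ccontr)
      assume "\<not> ?thesis"
      then have "x powr r / t = 1" "1 / t = 1" using x t ln_eq_minus_one[of "x powr r / t"] ln_eq_minus_one[of "1 / t"] by auto
      then have "x powr r = 1" by auto
      then show False using x ne assms by (simp add: powr_eq_one_iff_gen)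
    qed
    have lns: "ln (x powr r / t) = r * ln x - ln t" "ln (1 / t) = - ln t"
      using x t by (simp_all add: ln_div ln_powr)
    have "ln x - ln t = (1 / r) * ln (x powr r / t) + (1 - 1 / r) * ln (1 / t)"
      unfolding lns using assms by (simp add: algebra_simps)
    also have "\<dots> < (1 / r) * (x powr r / t - 1) + (1 - 1 / r) * (1 / t - 1)"
      using strict
    proof
      assume "ln (x powr r / t) \<noteq> x powr r / t - 1"
      then have "(1 / r) * ln (x powr r / t) < (1 / r) * (x powr r / t - 1)"
        using l1 r by (intro mult_strict_left_mono) auto
      moreover have "(1 - 1 / r) * ln (1 / t) \<le> (1 - 1 / r) * (1 / t - 1)"
        using l2 r by (intro mult_left_mono) auto
      ultimately show ?thesis by linarith
    next
      assume "ln (1 / t) \<noteq> 1 / t - 1"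
      then have "(1 - 1 / r) * ln (1 / t) < (1 - 1 / r) * (1 / t - 1)"
        using l2 r by (intro mult_strict_left_mono) auto
      moreover have "(1 / r) * ln (x powr r / t) \<le> (1 / r) * (x powr r / t - 1)"
        using l1 r by (intro mult_left_mono) auto
      ultimately show ?thesis by linarith
    qed
    also have "\<dots> = (x powr r / r + (1 - 1 / r)) / t - 1"
      by (simp add: algebra_simps add_divide_distrib diff_divide_distrib)
    also have "\<dots> = t / t - 1" by (simp only: t_def)
    also have "\<dots> = 0" using t by simp
    finally have "ln x < ln t" by simp
    then show ?thesis using x t by (simp add: t_def)
  qed (use assms in auto)
  then show "x \<noteq> 1 \<Longrightarrow> x < x powr r / r + (1 - 1 / r)" by simp
  show "x \<le> x powr r / r + (1 - 1 / r)"
    using strict by (cases "x = 1") auto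
qed

lemma (in prob_space) nn_integral_le_ennreal_root:
  fixes f :: "_ \<Rightarrow> real"
  assumes [measurable]: "f \<in> borel_measurable M" and nonneg: "\<And>x. 0 \<le> f x" and r: "1 < r"
  shows "(\<integral>\<^sup>+x. ennreal (f x) \<partial>M) \<le> ennreal_root r (\<integral>\<^sup>+x. ennreal (f x powr r) \<partial>M)"
proof (cases "(\<integral>\<^sup>+x. ennreal (f x powr r) \<partial>M) = \<infinity>")
  case False
  define I where "I = enn2real (\<integral>\<^sup>+x. ennreal (f x powr r) \<partial>M)"
  have I: "(\<integral>\<^sup>+x. ennreal (f x powr r) \<partial>M) = ennreal I" "I \<ge> 0"
    using False by (auto simp: I_def less_top)
  define c where "c = I powr (1 / r)"
  have root: "ennreal_root r (\<integral>\<^sup>+x. ennreal (f x powr r) \<partial>M) = ennreal c"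
    using False by (simp add: ennreal_root_def c_def I_def)
  show ?thesis
  \<comment> \<open>Division by \<open>c\<close> requires a nonzero norm. If the norm vanishes,
    \<open>f\<close> is zero almost everywhere and both sides are 0.\<close>
  proof (cases "I = 0")
    case True
    then have "AE x in M. ennreal (f x powr r) = 0"
      using I by (subst nn_integral_0_iff_AE[symmetric]) auto
    then have "AE x in M. ennreal (f x) = 0" by eventually_elim simp
    then have "(\<integral>\<^sup>+x. ennreal (f x) \<partial>M) = 0" by (subst nn_integral_0_iff_AE) auto
    then show ?thesis by simp
  next
    case False
    then have c: "c > 0" using I by (simp add: c_def)
    have cr: "c powr r = I" using I False r by (simp add: c_def powr_powr)
    have "f x \<le> c / (r * I) * (f x powr r) + c * (1 - 1 / r)" for x
    proof -
      have "f x / c \<le> (f x / c) powr r / r + (1 - 1 / r)"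
        using nonneg c r by (intro powr_young) auto
      also have "(f x / c) powr r = f x powr r / I"
        using nonneg c by (simp add: powr_divide cr)
      finally have "f x \<le> c * (f x powr r / I / r + (1 - 1 / r))"
        using c by (simp add: pos_divide_le_eq mult.commute)
      then show ?thesis by (simp add: algebra_simps)
    qed
    then have "(\<integral>\<^sup>+x. ennreal (f x) \<partial>M) \<le> (\<integral>\<^sup>+x. ennreal (c / (r * I)) * ennreal (f x powr r) + ennreal (c * (1 - 1 / r)) \<partial>M)"
      using c r I by (intro nn_integral_mono) (simp add: ennreal_mult[symmetric] ennreal_plus[symmetric] del: ennreal_plus)
    also have "\<dots> = ennreal (c / (r * I)) * ennreal I + ennreal (c * (1 - 1 / r))"
      by (subst nn_integral_add) (auto simp: nn_integral_cmult I emeasure_space_1)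
    also have "\<dots> = ennreal (c / (r * I) * I + c * (1 - 1 / r))"
      using c r I by (simp add: ennreal_mult[symmetric] ennreal_plus[symmetric] del: ennreal_plus)
    also have "c / (r * I) * I + c * (1 - 1 / r) = c" using False r by (simp add: field_simps)
    finally show ?thesis by (simp add: root)
  qed
qed (simp add: ennreal_root_def)

text \<open>Integrating Young's inequality bounds the mean by
  \<open>1 / r + (1 - 1 / r) = 1\<close>. Equality would force \<open>f = 1\<close> almost
  everywhere, and then the integral of \<open>ln (f x)\<close> would be 0.\<close>

lemma (in prob_space) expectation_less_1:
  fixes f :: "_ \<Rightarrow> real"
  assumes [measurable]: "f \<in> borel_measurable M" and nonneg: "\<And>x. 0 \<le> f x" and r: "1 < r"
    and int1: "(\<integral>x. f x powr r \<partial>M) = 1" and log: "(\<integral>x. ln (f x) \<partial>M) \<noteq> 0"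
  shows "integrable M f" "(\<integral>x. f x \<partial>M) < 1"
proof -
  \<comment> \<open>A Bochner integral of a function that is not integrable is 0 by default, so the
    value 1 already yields integrability.\<close>
  have ip: "integrable M (\<lambda>x. f x powr r)"
    using int1 not_integrable_integral_eq[of M "\<lambda>x. f x powr r"] by force
  let ?g = "\<lambda>x. f x powr r / r + (1 - 1 / r)"
  have ig: "integrable M ?g" using ip by simp
  have le: "f x \<le> ?g x" for x using powr_young(1)[OF nonneg r] .
  show i: "integrable M f"
    by (rule Bochner_Integration.integrable_bound[OF ig]) (use le nonneg in \<open>auto intro!: order_trans[OF le abs_ge_self]\<close>)
  have Ig: "(\<integral>x. ?g x \<partial>M) = 1" using ip int1 by (simp add: prob_space)
  have le1: "(\<integral>x. f x \<partial>M) \<le> 1"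
    using integral_mono[OF i ig] le Ig by simp
  have "(\<integral>x. f x \<partial>M) \<noteq> 1"
  proof
    assume "(\<integral>x. f x \<partial>M) = 1"
    then have "(\<integral>x. ?g x - f x \<partial>M) = 0"
      using i ig Ig by (subst Bochner_Integration.integral_diff) auto
    then have "AE x in M. ?g x - f x = 0"
      by (subst (asm) integral_nonneg_eq_0_iff_AE) (use i ig le in simp_all)
    then have "AE x in M. ln (f x) = 0"
    proof eventually_elim
      case (elim x)
      then have "f x = 1" using powr_young(2)[OF nonneg r, of x] by force
      then show ?case by simp
    qed
    then have "(\<integral>x. ln (f x) \<partial>M) = 0" by (simp add: integral_eq_zero_AE)
    then show False using log by simp
  qed
  then show "(\<integral>x. f x \<partial>M) < 1" using le1 by simp
qed

section \<open>Couplings of affine recursions\<close>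

text \<open>One SGD step as a function of the random pair (matrix, vector), so that the online and
  the offline chain differ only in the law of that pair.\<close>

definition affine_step :: "real \<Rightarrow> (real^'d^'d) \<times> (real^'d) \<Rightarrow> real^'d \<Rightarrow> real^'d" where
  "affine_step \<eta> z x = (mat 1 - \<eta> *\<^sub>R fst z) *v x + \<eta> *\<^sub>R snd z"

lemma continuous_on_matrix_vector_mult [continuous_intros]:
  fixes f :: "_ \<Rightarrow> real^'n^'m"
  assumes "continuous_on S f" "continuous_on S g"
  shows "continuous_on S (\<lambda>x. f x *v g x)"
  unfolding matrix_vector_mult_def using assms by (intro continuous_intros)

lemma affine_step_measurable [measurable]:
  "(\<lambda>(x, z). affine_step \<eta> z x) \<in> borel \<Otimes>\<^sub>M borel \<rightarrow>\<^sub>M (borel :: (real^'d) measure)"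
  unfolding borel_prod case_prod_beta affine_step_def
  by (intro borel_measurable_continuous_onI continuous_intros)

lemma norm_affine_step_le:
  assumes "\<eta> \<ge> 0"
  shows "norm (affine_step \<eta> z x) \<le> spectral_norm (mat 1 - \<eta> *\<^sub>R fst z) * norm x + \<eta> * norm (snd z)"
  unfolding affine_step_def
  by (rule order_trans[OF norm_triangle_ineq add_mono[OF norm_matrix_vector_le]]) (use assms in simp)

text \<open>The split is deliberately asymmetric: the first matrix acts on \<open>x - x'\<close>,
  and the difference of the matrices acts on \<open>x'\<close>. Hence the contraction factor will
  come from the online data and the moment from the offline stationary law.\<close>

lemma norm_affine_step_diff_le:
  assumes "\<eta> \<ge> 0"
  shows "norm (affine_step \<eta> z x - affine_step \<eta> z' x') \<le>
    spectral_norm (mat 1 - \<eta> *\<^sub>R fst z) * norm (x - x') +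
    \<eta> * (norm x' * spectral_norm (fst (z - z')) + norm (snd (z - z')))"
proof -
  have eq: "affine_step \<eta> z x - affine_step \<eta> z' x' =
    (mat 1 - \<eta> *\<^sub>R fst z) *v (x - x') + \<eta> *\<^sub>R ((fst z' - fst z) *v x' + snd (z - z'))"
    unfolding affine_step_def
    by (simp add: algebra_simps scaleR_matrix_vector_assoc[symmetric])
  have "norm ((fst z' - fst z) *v x') \<le> spectral_norm (fst (z - z')) * norm x'"
    using norm_matrix_vector_le[of "fst z' - fst z" x'] spectral_norm_minus_commute[of "fst z" "fst z'"]
    by simp
  then have "norm ((fst z' - fst z) *v x' + snd (z - z')) \<le>
      norm x' * spectral_norm (fst (z - z')) + norm (snd (z - z'))"
    by (intro order_trans[OF norm_triangle_ineq]) (simp add: mult.commute)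
  then have "norm (\<eta> *\<^sub>R ((fst z' - fst z) *v x' + snd (z - z'))) \<le>
      \<eta> * (norm x' * spectral_norm (fst (z - z')) + norm (snd (z - z')))"
    unfolding norm_scaleR using assms by (intro mult_mono) auto
  then show ?thesis unfolding eq
    by (intro order_trans[OF norm_triangle_ineq add_mono[OF norm_matrix_vector_le]])
qed

text \<open>Invariance under the kernel is restated with independent variables: if \<open>x\<close>
  has law \<pi> and \<open>z\<close> has law \<mu>, the step again has law \<pi>. Both sides
  integrate the same sections of a preimage, by Tonelli.\<close>

lemma stationary_affine_step:
  assumes st: "stationary_distribution K \<pi>" and K: "\<And>x. K x = distr \<mu> borel (\<lambda>z. affine_step \<eta> z x)"
    and \<mu>: "prob_space \<mu>" "sets \<mu> = sets borel"
  shows "distr (\<pi> \<Otimes>\<^sub>M \<mu>) borel (\<lambda>(x, z). affine_step \<eta> z x) = \<pi>"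
proof -
  interpret \<mu>: prob_space \<mu> by fact
  have \<pi>: "prob_space \<pi>" "sets \<pi> = sets borel" "\<pi> \<bind> K = \<pi>"
    using st by (auto simp: stationary_distribution_def)
  interpret \<pi>: prob_space \<pi> by fact
  interpret P: pair_prob_space \<pi> \<mu> ..
  note [measurable_cong] = \<pi>(2) \<mu>(2)
  have m: "(\<lambda>(x, z). affine_step \<eta> z x) \<in> \<pi> \<Otimes>\<^sub>M \<mu> \<rightarrow>\<^sub>M borel" by measurable
  have "K \<in> borel \<rightarrow>\<^sub>M subprob_algebra borel"
    unfolding K by (rule measurable_distr2[where M = \<mu>])
      (auto simp: space_subprob_algebra \<mu>.subprob_space_axioms)
  then have mK: "K \<in> \<pi> \<rightarrow>\<^sub>M subprob_algebra borel"
    by (simp cong: measurable_cong_sets)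
  have "distr (\<pi> \<Otimes>\<^sub>M \<mu>) borel (\<lambda>(x, z). affine_step \<eta> z x) = \<pi> \<bind> K"
  proof (rule measure_eqI)
    show "sets (distr (\<pi> \<Otimes>\<^sub>M \<mu>) borel (\<lambda>(x, z). affine_step \<eta> z x)) = sets (\<pi> \<bind> K)"
      using \<pi> by simp
    fix A assume "A \<in> sets (distr (\<pi> \<Otimes>\<^sub>M \<mu>) borel (\<lambda>(x, z). affine_step \<eta> z x))"
    then have A: "A \<in> sets borel" by simp
    have "emeasure (\<pi> \<bind> K) A = (\<integral>\<^sup>+x. emeasure (K x) A \<partial>\<pi>)"
      using A mK by (intro emeasure_bind) (auto simp: \<pi>.not_empty)
    also have "\<dots> = (\<integral>\<^sup>+x. emeasure \<mu> ((\<lambda>z. affine_step \<eta> z x) -` A \<inter> space \<mu>) \<partial>\<pi>)"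
    proof (rule nn_integral_cong)
      fix x assume "x \<in> space \<pi>"
      have "(\<lambda>z. affine_step \<eta> z x) \<in> \<mu> \<rightarrow>\<^sub>M borel"
        using measurable_Pair2[OF m \<open>x \<in> space \<pi>\<close>] by simp
      then show "emeasure (K x) A = emeasure \<mu> ((\<lambda>z. affine_step \<eta> z x) -` A \<inter> space \<mu>)"
        unfolding K using A by (rule emeasure_distr)
    qed
    also have "\<dots> = emeasure (\<pi> \<Otimes>\<^sub>M \<mu>) ((\<lambda>(x, z). affine_step \<eta> z x) -` A \<inter> space (\<pi> \<Otimes>\<^sub>M \<mu>))"
      by (subst \<mu>.emeasure_pair_measure_alt[OF measurable_sets[OF m A]])
        (auto intro!: nn_integral_cong arg_cong[where f = "emeasure \<mu>"] simp: space_pair_measure)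
    also have "\<dots> = emeasure (distr (\<pi> \<Otimes>\<^sub>M \<mu>) borel (\<lambda>(x, z). affine_step \<eta> z x)) A"
      using emeasure_distr[OF m A] by simp
    finally show "emeasure (distr (\<pi> \<Otimes>\<^sub>M \<mu>) borel (\<lambda>(x, z). affine_step \<eta> z x)) A = emeasure (\<pi> \<bind> K) A" by simp
  qed
  with \<pi> show ?thesis by simp
qed

section \<open>Integrals against products and couplings\<close>

lemma (in sigma_finite_measure) nn_integral_pair_mult:
  assumes [measurable]: "f \<in> borel_measurable N" "g \<in> borel_measurable M"
  shows "(\<integral>\<^sup>+w. f (fst w) * g (snd w) \<partial>(N \<Otimes>\<^sub>M M)) = (\<integral>\<^sup>+x. f x \<partial>N) * (\<integral>\<^sup>+z. g z \<partial>M)"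
proof -
  have "(\<integral>\<^sup>+w. f (fst w) * g (snd w) \<partial>(N \<Otimes>\<^sub>M M)) = (\<integral>\<^sup>+x. \<integral>\<^sup>+z. f x * g z \<partial>M \<partial>N)"
    by (subst nn_integral_fst[symmetric]) auto
  also have "\<dots> = (\<integral>\<^sup>+x. f x \<partial>N) * (\<integral>\<^sup>+z. g z \<partial>M)"
    by (simp add: nn_integral_cmult nn_integral_multc)
  finally show ?thesis .
qed

lemma coupling_nn_integral:
  assumes \<gamma>: "\<gamma> \<in> couplings \<mu> \<nu>"
  shows "f \<in> borel_measurable borel \<Longrightarrow> (\<integral>\<^sup>+w. f (fst w) \<partial>\<gamma>) = (\<integral>\<^sup>+x. f x \<partial>\<mu>)"
    and "f \<in> borel_measurable borel \<Longrightarrow> (\<integral>\<^sup>+w. f (snd w) \<partial>\<gamma>) = (\<integral>\<^sup>+x. f x \<partial>\<nu>)"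
proof -
  have [measurable_cong]: "sets \<gamma> = sets (borel \<Otimes>\<^sub>M borel)"
    and d: "distr \<gamma> borel fst = \<mu>" "distr \<gamma> borel snd = \<nu>"
    using \<gamma> by (auto simp: couplings_def)
  have [measurable]: "fst \<in> \<gamma> \<rightarrow>\<^sub>M borel" "snd \<in> \<gamma> \<rightarrow>\<^sub>M borel" by measurable
  show "f \<in> borel_measurable borel \<Longrightarrow> (\<integral>\<^sup>+w. f (fst w) \<partial>\<gamma>) = (\<integral>\<^sup>+x. f x \<partial>\<mu>)"
    unfolding d[symmetric] by (subst nn_integral_distr) auto
  show "f \<in> borel_measurable borel \<Longrightarrow> (\<integral>\<^sup>+w. f (snd w) \<partial>\<gamma>) = (\<integral>\<^sup>+x. f x \<partial>\<nu>)"
    unfolding d[symmetric] by (subst nn_integral_distr) auto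
qed

lemma ennreal_root_1 [simp]: "ennreal_root 1 t = t"
  by (auto simp: ennreal_root_def less_top)

lemma wasserstein_1_le:
  assumes "\<gamma> \<in> couplings \<mu> \<nu>"
  shows "wasserstein 1 norm \<mu> \<nu> \<le> (\<integral>\<^sup>+w. ennreal (norm (fst w - snd w)) \<partial>\<gamma>)"
  unfolding wasserstein_def using assms by (intro INF_lower2[of \<gamma>]) auto

text \<open>The product of \<gamma> and \<kappa> makes the two states independent of the two data
  pairs. Each marginal of the image is then one step from a product of a stationary law with its own
  data law, so invariance applies to each coordinate.\<close>

lemma couplings_affine_step:
  assumes \<gamma>: "\<gamma> \<in> couplings \<pi> \<pi>'" and \<kappa>: "\<kappa> \<in> couplings \<mu> \<mu>'"
    and inv: "distr (\<pi> \<Otimes>\<^sub>M \<mu>) borel (\<lambda>(x, z). affine_step \<eta> z x) = \<pi>"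
    and inv': "distr (\<pi>' \<Otimes>\<^sub>M \<mu>') borel (\<lambda>(x, z). affine_step \<eta> z x) = \<pi>'"
  shows "distr (\<gamma> \<Otimes>\<^sub>M \<kappa>) (borel \<Otimes>\<^sub>M borel)
    (\<lambda>(w, v). (affine_step \<eta> (fst v) (fst w), affine_step \<eta> (snd v) (snd w))) \<in> couplings \<pi> \<pi>'"
proof -
  have \<gamma>': "prob_space \<gamma>" "sets \<gamma> = sets (borel \<Otimes>\<^sub>M borel)" "distr \<gamma> borel fst = \<pi>" "distr \<gamma> borel snd = \<pi>'"
    and \<kappa>': "prob_space \<kappa>" "sets \<kappa> = sets (borel \<Otimes>\<^sub>M borel)" "distr \<kappa> borel fst = \<mu>" "distr \<kappa> borel snd = \<mu>'"
    using assms by (auto simp: couplings_def)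
  interpret \<gamma>: prob_space \<gamma> by fact
  interpret \<kappa>: prob_space \<kappa> by fact
  interpret P: pair_prob_space \<gamma> \<kappa> ..
  note [measurable_cong] = \<gamma>'(2) \<kappa>'(2)
  have [measurable]: "fst \<in> \<gamma> \<rightarrow>\<^sub>M borel" "snd \<in> \<gamma> \<rightarrow>\<^sub>M borel" "fst \<in> \<kappa> \<rightarrow>\<^sub>M borel" "snd \<in> \<kappa> \<rightarrow>\<^sub>M borel"
    by measurable
  have m: "(\<lambda>(w, v). affine_step \<eta> (f v) (g w)) \<in> \<gamma> \<Otimes>\<^sub>M \<kappa> \<rightarrow>\<^sub>M borel"
    if [measurable]: "f \<in> \<kappa> \<rightarrow>\<^sub>M borel" "g \<in> \<gamma> \<rightarrow>\<^sub>M borel" for f g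
    using measurable_compose[of "\<lambda>(w, v). (g w, f v)" "\<gamma> \<Otimes>\<^sub>M \<kappa>" _ _ _, OF _ affine_step_measurable[of \<eta>]]
    by (simp add: case_prod_beta)
  \<comment> \<open>The image of a product measure under a product map is the product of the images;
    it is used once for the first and once for the second coordinates.\<close>
  have marg: "distr (\<gamma> \<Otimes>\<^sub>M \<kappa>) borel (\<lambda>(w, v). affine_step \<eta> (f v) (g w)) =
      distr (distr \<gamma> borel g \<Otimes>\<^sub>M distr \<kappa> borel f) borel (\<lambda>(x, z). affine_step \<eta> z x)"
    if [measurable]: "f \<in> \<kappa> \<rightarrow>\<^sub>M borel" "g \<in> \<gamma> \<rightarrow>\<^sub>M borel" for f g
  proof -
    interpret F: prob_space "distr \<kappa> borel f" by (rule \<kappa>.prob_space_distr) fact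
    show ?thesis
      by (subst pair_measure_distr) (auto simp: F.sigma_finite_measure_axioms distr_distr comp_def case_prod_unfold)
  qed
  let ?h = "\<lambda>(w, v). (affine_step \<eta> (fst v) (fst w), affine_step \<eta> (snd v) (snd w))"
  have h: "?h \<in> \<gamma> \<Otimes>\<^sub>M \<kappa> \<rightarrow>\<^sub>M borel \<Otimes>\<^sub>M borel"
    using m[of fst fst] m[of snd snd] by (simp add: case_prod_beta)
  have "distr (distr (\<gamma> \<Otimes>\<^sub>M \<kappa>) (borel \<Otimes>\<^sub>M borel) ?h) borel fst = \<pi>"
    using marg[of fst fst] inv \<gamma>'(3) \<kappa>'(3) by (subst distr_distr[OF _ h]) (auto simp: comp_def case_prod_unfold)
  moreover have "distr (distr (\<gamma> \<Otimes>\<^sub>M \<kappa>) (borel \<Otimes>\<^sub>M borel) ?h) borel snd = \<pi>'"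
    using marg[of snd snd] inv' \<gamma>'(4) \<kappa>'(4) by (subst distr_distr[OF _ h]) (auto simp: comp_def case_prod_unfold)
  ultimately show ?thesis
    using P.prob_space_distr[OF h] by (simp add: couplings_def)
qed

text \<open>The coupling obtained after one step is a competitor for the infimum. Its cost is
  bounded pointwise, and independence factorizes the integral of every product of a state term and a
  data term.\<close>

lemma wasserstein_affine_step_le:
  fixes \<pi> \<pi>' :: "(real^'d) measure"
  assumes \<gamma>: "\<gamma> \<in> couplings \<pi> \<pi>'" and \<kappa>: "\<kappa> \<in> couplings \<mu> \<mu>'" and \<eta>: "\<eta> \<ge> 0"
    and inv: "distr (\<pi> \<Otimes>\<^sub>M \<mu>) borel (\<lambda>(x, z). affine_step \<eta> z x) = \<pi>"
    and inv': "distr (\<pi>' \<Otimes>\<^sub>M \<mu>') borel (\<lambda>(x, z). affine_step \<eta> z x) = \<pi>'"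
  shows "wasserstein 1 norm \<pi> \<pi>' \<le>
    (\<integral>\<^sup>+w. ennreal (norm (fst w - snd w)) \<partial>\<gamma>) * (\<integral>\<^sup>+z. ennreal (spectral_norm (mat 1 - \<eta> *\<^sub>R fst z)) \<partial>\<mu>) +
    ennreal \<eta> * ((\<integral>\<^sup>+x. ennreal (norm x) \<partial>\<pi>') * (\<integral>\<^sup>+v. ennreal (spectral_norm (fst (fst v - snd v))) \<partial>\<kappa>) +
      (\<integral>\<^sup>+v. ennreal (norm (snd (fst v - snd v))) \<partial>\<kappa>))"
proof -
  have \<gamma>': "prob_space \<gamma>" "sets \<gamma> = sets (borel \<Otimes>\<^sub>M borel)"
    and \<kappa>': "prob_space \<kappa>" "sets \<kappa> = sets (borel \<Otimes>\<^sub>M borel)"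
    using assms by (auto simp: couplings_def)
  interpret \<gamma>: prob_space \<gamma> by fact
  interpret \<kappa>: prob_space \<kappa> by fact
  note [measurable_cong] = \<gamma>'(2) \<kappa>'(2)
  have [measurable]: "(fst :: (real^'d^'d) \<times> (real^'d) \<Rightarrow> _) \<in> borel \<rightarrow>\<^sub>M borel"
      "(snd :: (real^'d^'d) \<times> (real^'d) \<Rightarrow> _) \<in> borel \<rightarrow>\<^sub>M borel"
    by (auto intro!: borel_measurable_continuous_onI continuous_intros)
  let ?h = "\<lambda>(w, v). (affine_step \<eta> (fst v) (fst w), affine_step \<eta> (snd v) (snd w))"
  have h [measurable]: "?h \<in> \<gamma> \<Otimes>\<^sub>M \<kappa> \<rightarrow>\<^sub>M borel \<Otimes>\<^sub>M borel"
    using measurable_compose[OF _ affine_step_measurable[of \<eta>], of "\<lambda>(w, v). (fst w, fst v)" "\<gamma> \<Otimes>\<^sub>M \<kappa>"]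
      measurable_compose[OF _ affine_step_measurable[of \<eta>], of "\<lambda>(w, v). (snd w, snd v)" "\<gamma> \<Otimes>\<^sub>M \<kappa>"]
    by (simp add: case_prod_unfold)
  have dm [measurable]: "(\<lambda>v. fst v - snd v :: (real^'d^'d) \<times> (real^'d)) \<in> \<kappa> \<rightarrow>\<^sub>M borel" by measurable
  define f1 where "f1 = (\<lambda>w :: (real^'d) \<times> (real^'d). ennreal (norm (fst w - snd w)))"
  define f2 where "f2 = (\<lambda>w :: (real^'d) \<times> (real^'d). ennreal (norm (snd w)))"
  define g1 where "g1 = (\<lambda>v :: ((real^'d^'d) \<times> (real^'d)) \<times> ((real^'d^'d) \<times> (real^'d)). ennreal (spectral_norm (mat 1 - \<eta> *\<^sub>R fst (fst v))))"
  define g2 where "g2 = (\<lambda>v :: ((real^'d^'d) \<times> (real^'d)) \<times> ((real^'d^'d) \<times> (real^'d)). ennreal (spectral_norm (fst (fst v - snd v))))"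
  define g3 where "g3 = (\<lambda>v :: ((real^'d^'d) \<times> (real^'d)) \<times> ((real^'d^'d) \<times> (real^'d)). ennreal (norm (snd (fst v - snd v))))"
  have [measurable]: "f1 \<in> borel_measurable \<gamma>" "f2 \<in> borel_measurable \<gamma>" unfolding f1_def f2_def by measurable
  have [measurable]: "g1 \<in> borel_measurable \<kappa>" unfolding g1_def by measurable
  have [measurable]: "g2 \<in> borel_measurable \<kappa>" unfolding g2_def by measurable
  have [measurable]: "g3 \<in> borel_measurable \<kappa>" unfolding g3_def by measurable
  have "wasserstein 1 norm \<pi> \<pi>' \<le> (\<integral>\<^sup>+w. ennreal (norm (fst w - snd w)) \<partial>distr (\<gamma> \<Otimes>\<^sub>M \<kappa>) (borel \<Otimes>\<^sub>M borel) ?h)"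
    by (rule wasserstein_1_le[OF couplings_affine_step[OF \<gamma> \<kappa> inv inv']])
  also have "\<dots> = (\<integral>\<^sup>+u. ennreal (norm (fst (?h u) - snd (?h u))) \<partial>(\<gamma> \<Otimes>\<^sub>M \<kappa>))"
    by (rule nn_integral_distr[OF h]) measurable
  \<comment> \<open>The factor 1 writes the last term as a product too, so that the same Tonelli
    lemma evaluates all three.\<close>
  also have "\<dots> \<le> (\<integral>\<^sup>+u. f1 (fst u) * g1 (snd u) + ennreal \<eta> * (f2 (fst u) * g2 (snd u) + 1 * g3 (snd u)) \<partial>(\<gamma> \<Otimes>\<^sub>M \<kappa>))"
  proof (rule nn_integral_mono)
    fix u :: "((real^'d) \<times> (real^'d)) \<times> ((real^'d^'d) \<times> (real^'d)) \<times> ((real^'d^'d) \<times> (real^'d))"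
    obtain x x' z z' where u: "u = ((x, x'), (z, z'))" by (cases u) auto
    have "ennreal (norm (affine_step \<eta> z x - affine_step \<eta> z' x')) \<le>
      ennreal (spectral_norm (mat 1 - \<eta> *\<^sub>R fst z) * norm (x - x') +
        \<eta> * (norm x' * spectral_norm (fst (z - z')) + norm (snd (z - z'))))"
      by (rule ennreal_leI[OF norm_affine_step_diff_le[OF \<eta>]])
    also have "\<dots> = f1 (fst u) * g1 (snd u) + ennreal \<eta> * (f2 (fst u) * g2 (snd u) + 1 * g3 (snd u))"
      using \<eta> by (simp add: u f1_def f2_def g1_def g2_def g3_def ennreal_mult'' ennreal_plus mult.commute)
    finally show "ennreal (norm (fst (?h u) - snd (?h u))) \<le> f1 (fst u) * g1 (snd u) + ennreal \<eta> * (f2 (fst u) * g2 (snd u) + 1 * g3 (snd u))"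
      by (simp add: u)
  qed
  also have "\<dots> = (\<integral>\<^sup>+u. f1 (fst u) * g1 (snd u) \<partial>(\<gamma> \<Otimes>\<^sub>M \<kappa>)) +
      ennreal \<eta> * ((\<integral>\<^sup>+u. f2 (fst u) * g2 (snd u) \<partial>(\<gamma> \<Otimes>\<^sub>M \<kappa>)) + (\<integral>\<^sup>+u. 1 * g3 (snd u) \<partial>(\<gamma> \<Otimes>\<^sub>M \<kappa>)))"
    by (subst nn_integral_add, simp, simp, subst nn_integral_cmult, simp, subst nn_integral_add) simp_all
  also have "\<dots> = integral\<^sup>N \<gamma> f1 * integral\<^sup>N \<kappa> g1 +
      ennreal \<eta> * (integral\<^sup>N \<gamma> f2 * integral\<^sup>N \<kappa> g2 + 1 * integral\<^sup>N \<kappa> g3)"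
    using \<kappa>.nn_integral_pair_mult[of "\<lambda>_. 1" \<gamma> g3]
    by (simp add: \<kappa>.nn_integral_pair_mult \<gamma>.emeasure_space_1)
  also have "integral\<^sup>N \<gamma> f2 = (\<integral>\<^sup>+x. ennreal (norm x) \<partial>\<pi>')"
    unfolding f2_def by (rule coupling_nn_integral(2)[OF \<gamma>]) measurable
  also have "integral\<^sup>N \<kappa> g1 = (\<integral>\<^sup>+z. ennreal (spectral_norm (mat 1 - \<eta> *\<^sub>R fst z)) \<partial>\<mu>)"
    unfolding g1_def by (rule coupling_nn_integral(1)[OF \<kappa>]) measurable
  finally show ?thesis by (simp add: f1_def g2_def g3_def)
qed

text \<open>Moments of a stationary law are not known in advance, so the moment is truncated: with
  \<open>\<phi>\<^sub>R t = min t R\<close>, stationarity gives \<open>E (\<phi>\<^sub>R |X| - \<phi>\<^sub>R (\<delta> |X|)) \<le> \<eta> E |b|\<close>, and the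
  integrand tends to \<open>(1 - \<delta>) |X|\<close> as \<open>R\<close> grows.\<close>

lemma stationary_first_moment_finite:
  fixes \<pi> :: "(real^'d) measure"
  assumes \<pi>: "prob_space \<pi>" "sets \<pi> = sets borel" and \<mu>: "prob_space \<mu>" "sets \<mu> = sets borel"
    and \<eta>: "\<eta> \<ge> 0"
    and inv: "distr (\<pi> \<Otimes>\<^sub>M \<mu>) borel (\<lambda>(x, z). affine_step \<eta> z x) = \<pi>"
    and \<delta>: "(\<integral>\<^sup>+z. ennreal (spectral_norm (mat 1 - \<eta> *\<^sub>R fst z)) \<partial>\<mu>) = ennreal \<delta>" "0 \<le> \<delta>" "\<delta> < 1"
    and fin: "(\<integral>\<^sup>+z. ennreal (norm (snd z)) \<partial>\<mu>) < \<infinity>"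
  shows "(\<integral>\<^sup>+x. ennreal (norm x) \<partial>\<pi>) < \<infinity>"
proof -
  interpret \<mu>: prob_space \<mu> by fact
  interpret \<pi>: prob_space \<pi> by fact
  note [measurable_cong] = \<pi>(2) \<mu>(2)
  have [measurable]: "(fst :: (real^'d^'d) \<times> (real^'d) \<Rightarrow> _) \<in> borel \<rightarrow>\<^sub>M borel"
      "(snd :: (real^'d^'d) \<times> (real^'d) \<Rightarrow> _) \<in> borel \<rightarrow>\<^sub>M borel"
    by (auto intro!: borel_measurable_continuous_onI continuous_intros)
  define \<beta> where "\<beta> = ennreal \<eta> * (\<integral>\<^sup>+z. ennreal (norm (snd z)) \<partial>\<mu>)"
  have \<beta>: "\<beta> < \<infinity>" using fin by (simp add: \<beta>_def ennreal_mult_less_top)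
  \<comment> \<open>The truncation level runs through the naturals, ready for Fatou's lemma. The
    difference is nonnegative because \<delta> is below 1, so \<open>ennreal\<close> does not cut it
    off.\<close>
  define D where "D = (\<lambda>(n::nat) (x::real^'d). ennreal (min (norm x) (real n) - min (\<delta> * norm x) (real n)))"
  have [measurable]: "D n \<in> borel_measurable \<pi>" for n unfolding D_def by measurable
  have D_le: "(\<integral>\<^sup>+x. D n x \<partial>\<pi>) \<le> \<beta>" for n
  proof -
    \<comment> \<open>Thanks to the truncation \<open>T\<close> is at most \<open>n\<close>, hence
      finite, and can be cancelled in \<open>T + E D \<le> T + \<beta>\<close>. Without truncation
      both sides might be infinite.\<close>
    define T where "T = (\<integral>\<^sup>+x. ennreal (min (\<delta> * norm x) (real n)) \<partial>\<pi>)"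
    have "T \<le> (\<integral>\<^sup>+x. ennreal (real n) \<partial>\<pi>)" unfolding T_def by (intro nn_integral_mono ennreal_leI) simp
    also have "\<dots> = ennreal (real n)" by (simp add: \<pi>.emeasure_space_1)
    finally have T: "T < \<infinity>" by (rule le_less_trans) simp
    have inner: "(\<integral>\<^sup>+z. ennreal (min (norm (affine_step \<eta> z x)) (real n)) \<partial>\<mu>) \<le>
      ennreal (min (\<delta> * norm x) (real n)) + \<beta>" for x
    proof -
      let ?m = "\<lambda>z. spectral_norm (mat 1 - \<eta> *\<^sub>R fst z) * norm x"
      have "(\<integral>\<^sup>+z. ennreal (min (norm (affine_step \<eta> z x)) (real n)) \<partial>\<mu>) \<le>
          (\<integral>\<^sup>+z. ennreal (min (?m z) (real n)) + ennreal \<eta> * ennreal (norm (snd z)) \<partial>\<mu>)"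
      proof (rule nn_integral_mono)
        fix z :: "(real^'d^'d) \<times> (real^'d)"
        \<comment> \<open>Truncation is subadditive: \<open>min (s + t) R \<le> min s R + t\<close>
          for nonnegative \<open>t\<close>.\<close>
        have "min (norm (affine_step \<eta> z x)) (real n) \<le> min (?m z) (real n) + \<eta> * norm (snd z)"
          using norm_affine_step_le[OF \<eta>, of z x] mult_nonneg_nonneg[OF \<eta> norm_ge_zero[of "snd z"]]
          by linarith
        from ennreal_leI[OF this] show "ennreal (min (norm (affine_step \<eta> z x)) (real n)) \<le>
          ennreal (min (?m z) (real n)) + ennreal \<eta> * ennreal (norm (snd z))"
          using \<eta> by (simp add: ennreal_mult'')
      qed
      also have "\<dots> = (\<integral>\<^sup>+z. ennreal (min (?m z) (real n)) \<partial>\<mu>) + \<beta>"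
        unfolding \<beta>_def by (simp add: nn_integral_add nn_integral_cmult)
      \<comment> \<open>Jensen's inequality for the concave truncation, obtained by bounding the
        minimum by each of its arguments in turn.\<close>
      also have "(\<integral>\<^sup>+z. ennreal (min (?m z) (real n)) \<partial>\<mu>) \<le> ennreal (min (\<delta> * norm x) (real n))"
      proof -
        have "(\<integral>\<^sup>+z. ennreal (min (?m z) (real n)) \<partial>\<mu>) \<le> (\<integral>\<^sup>+z. ennreal (?m z) \<partial>\<mu>)"
          by (intro nn_integral_mono ennreal_leI) simp
        also have "\<dots> = ennreal (\<delta> * norm x)"
          by (simp add: ennreal_mult'' nn_integral_multc \<delta>)
        finally have 1: "(\<integral>\<^sup>+z. ennreal (min (?m z) (real n)) \<partial>\<mu>) \<le> ennreal (\<delta> * norm x)" .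
        have "(\<integral>\<^sup>+z. ennreal (min (?m z) (real n)) \<partial>\<mu>) \<le> (\<integral>\<^sup>+z. ennreal (real n) \<partial>\<mu>)"
          by (intro nn_integral_mono ennreal_leI) simp
        also have "\<dots> = ennreal (real n)" by (simp add: \<mu>.emeasure_space_1)
        finally show ?thesis using 1 by (simp add: min_def)
      qed
      finally show ?thesis by (simp add: add_right_mono)
    qed
    have "T + (\<integral>\<^sup>+x. D n x \<partial>\<pi>) = (\<integral>\<^sup>+x. ennreal (min (\<delta> * norm x) (real n)) + D n x \<partial>\<pi>)"
      unfolding T_def by (simp add: nn_integral_add)
    also have "\<dots> = (\<integral>\<^sup>+x. ennreal (min (norm x) (real n)) \<partial>\<pi>)"
    proof (rule nn_integral_cong)
      fix x :: "real^'d"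
      have "\<delta> * norm x \<le> norm x" using \<delta> by (simp add: mult_left_le_one_le)
      then show "ennreal (min (\<delta> * norm x) (real n)) + D n x = ennreal (min (norm x) (real n))"
        unfolding D_def using \<delta> by (subst ennreal_plus[symmetric]) auto
    qed
    \<comment> \<open>Stationarity enters here: a state of law \<pi> is replaced by the state after
      one step.\<close>
    also have "\<dots> = (\<integral>\<^sup>+u. ennreal (min (norm ((\<lambda>(x, z). affine_step \<eta> z x) u)) (real n)) \<partial>(\<pi> \<Otimes>\<^sub>M \<mu>))"
      by (subst (1) inv[symmetric], subst nn_integral_distr) auto
    also have "\<dots> = (\<integral>\<^sup>+x. \<integral>\<^sup>+z. ennreal (min (norm (affine_step \<eta> z x)) (real n)) \<partial>\<mu> \<partial>\<pi>)"
      by (subst \<mu>.nn_integral_fst[symmetric]) auto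
    also have "\<dots> \<le> (\<integral>\<^sup>+x. ennreal (min (\<delta> * norm x) (real n)) + \<beta> \<partial>\<pi>)"
      by (intro nn_integral_mono inner)
    also have "\<dots> = T + \<beta>"
      unfolding T_def by (simp add: nn_integral_add \<pi>.emeasure_space_1)
    finally show ?thesis using T by (auto simp: ennreal_add_left_cancel_le)
  qed
  have lim: "liminf (\<lambda>n. D n x) = ennreal ((1 - \<delta>) * norm x)" for x :: "real^'d"
  proof -
    obtain k :: nat where k: "norm x \<le> real k" using real_arch_simple by blast
    \<comment> \<open>Once \<open>n\<close> exceeds \<open>norm x\<close> neither truncation is
      active, so the sequence is eventually constant.\<close>
    have "\<forall>\<^sub>F n in sequentially. D n x = ennreal ((1 - \<delta>) * norm x)"
      using eventually_ge_at_top[of k]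
    proof eventually_elim
      case (elim n)
      then have "norm x \<le> real n" using k by linarith
      moreover have "\<delta> * norm x \<le> norm x" using \<delta> by (simp add: mult_left_le_one_le)
      ultimately show ?case by (simp add: D_def algebra_simps min_def)
    qed
    then show ?thesis
      by (intro lim_imp_Liminf tendsto_eventually) auto
  qed
  \<comment> \<open>Fatou's lemma turns the bound \<beta>, uniform in \<open>n\<close>, into a bound
    on the full first moment; dividing by \<open>1 - \<delta> > 0\<close> keeps it finite.\<close>
  have "ennreal (1 - \<delta>) * (\<integral>\<^sup>+x. ennreal (norm x) \<partial>\<pi>) = (\<integral>\<^sup>+x. liminf (\<lambda>n. D n x) \<partial>\<pi>)"
    unfolding lim using \<delta> by (simp add: ennreal_mult'' nn_integral_cmult)
  also have "\<dots> \<le> liminf (\<lambda>n. \<integral>\<^sup>+x. D n x \<partial>\<pi>)"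
    by (rule nn_integral_liminf) simp
  also have "\<dots> \<le> \<beta>"
    by (rule order_trans[OF Liminf_le_Limsup Limsup_bounded]) (use D_le in auto)
  finally have "ennreal (1 - \<delta>) * (\<integral>\<^sup>+x. ennreal (norm x) \<partial>\<pi>) < \<infinity>" using \<beta> by (rule le_less_trans)
  then show ?thesis using \<delta> by (auto simp: ennreal_mult_less_top)
qed

text \<open>The independent coupling has cost at most the sum of the two first moments, by the
  triangle inequality.\<close>

lemma wasserstein_1_finite:
  fixes \<pi> \<pi>' :: "(real^'d) measure"
  assumes \<pi>: "prob_space \<pi>" "sets \<pi> = sets borel" and \<pi>': "prob_space \<pi>'" "sets \<pi>' = sets borel"
    and fin: "(\<integral>\<^sup>+x. ennreal (norm x) \<partial>\<pi>) < \<infinity>" "(\<integral>\<^sup>+x. ennreal (norm x) \<partial>\<pi>') < \<infinity>"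
  shows "wasserstein 1 norm \<pi> \<pi>' < \<infinity>"
proof -
  interpret \<pi>: prob_space \<pi> by fact
  interpret \<pi>': prob_space \<pi>' by fact
  interpret P: pair_prob_space \<pi> \<pi>' ..
  note [measurable_cong] = \<pi>(2) \<pi>'(2)
  have s: "sets (\<pi> \<Otimes>\<^sub>M \<pi>') = sets (borel \<Otimes>\<^sub>M borel)" using \<pi> \<pi>' by (intro sets_pair_measure_cong)
  have "distr (\<pi> \<Otimes>\<^sub>M \<pi>') borel fst = \<pi>"
    using \<pi>'.distr_pair_fst[of \<pi>] \<pi>(2) by (simp cong: distr_cong)
  moreover have "distr (\<pi> \<Otimes>\<^sub>M \<pi>') borel snd = \<pi>'"
  proof (rule measure_eqI)
    fix A assume "A \<in> sets (distr (\<pi> \<Otimes>\<^sub>M \<pi>') borel snd)"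
    then have A: "A \<in> sets borel" by simp
    then have "snd -` A \<inter> space (\<pi> \<Otimes>\<^sub>M \<pi>') = space \<pi> \<times> A"
      using \<pi>'(2) sets.sets_into_space[of A \<pi>'] by (auto simp: space_pair_measure)
    then show "emeasure (distr (\<pi> \<Otimes>\<^sub>M \<pi>') borel snd) A = emeasure \<pi>' A"
      using A \<pi>'(2) by (subst emeasure_distr) (auto simp: \<pi>'.emeasure_pair_measure_Times \<pi>.emeasure_space_1)
  qed (use \<pi>' in simp)
  ultimately have c: "\<pi> \<Otimes>\<^sub>M \<pi>' \<in> couplings \<pi> \<pi>'"
    unfolding couplings_def using s P.prob_space_axioms by simp
  have "wasserstein 1 norm \<pi> \<pi>' \<le> (\<integral>\<^sup>+w. ennreal (norm (fst w - snd w)) \<partial>(\<pi> \<Otimes>\<^sub>M \<pi>'))"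
    by (rule wasserstein_1_le[OF c])
  also have "\<dots> \<le> (\<integral>\<^sup>+w. ennreal (norm (fst w)) + ennreal (norm (snd w)) \<partial>(\<pi> \<Otimes>\<^sub>M \<pi>'))"
    by (intro nn_integral_mono) (simp add: norm_triangle_ineq4 flip: ennreal_plus)
  also have "\<dots> = (\<integral>\<^sup>+x. ennreal (norm x) \<partial>\<pi>) + (\<integral>\<^sup>+x. ennreal (norm x) \<partial>\<pi>')"
    using coupling_nn_integral[OF c, of "\<lambda>x. ennreal (norm x)"] by (subst nn_integral_add) auto
  also have "\<dots> < \<infinity>" using fin by simp
  finally show ?thesis .
qed

text \<open>Serves for both parts of the data error: \<open>f\<close> will be the spectral norm of
  the matrix component or the norm of the vector component.\<close>

lemma nn_integral_le_wasserstein_cost: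
  assumes "prob_space \<kappa>" "sets \<kappa> = sets (borel \<Otimes>\<^sub>M borel)" "1 < p"
    and f: "\<And>z. 0 \<le> f z" "\<And>z. f z \<le> pair_norm z"
  shows "(\<integral>\<^sup>+v. ennreal (f (fst v - snd v)) \<partial>\<kappa>) \<le>
    ennreal_root p (\<integral>\<^sup>+v. ennreal (pair_norm (fst v - snd v :: (real^'d^'d) \<times> (real^'d)) powr p) \<partial>\<kappa>)"
proof -
  interpret \<kappa>: prob_space \<kappa> by fact
  note [measurable_cong] = assms(2)
  have m: "(\<lambda>v. pair_norm (fst v - snd v :: (real^'d^'d) \<times> (real^'d))) \<in> borel_measurable \<kappa>"
    by measurable
  have "(\<integral>\<^sup>+v. ennreal (f (fst v - snd v)) \<partial>\<kappa>) \<le> (\<integral>\<^sup>+v. ennreal (pair_norm (fst v - snd v)) \<partial>\<kappa>)"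
    by (intro nn_integral_mono ennreal_leI f)
  also have "\<dots> \<le> ennreal_root p (\<integral>\<^sup>+v. ennreal (pair_norm (fst v - snd v) powr p) \<partial>\<kappa>)"
    by (rule \<kappa>.nn_integral_le_ennreal_root[OF m pair_norm_nonneg \<open>1 < p\<close>])
  finally show ?thesis .
qed

text \<open>Passing to the infimum gives \<open>W \<le> \<delta> * W + t\<close>, which can be
  solved for \<open>W\<close> because \<open>W\<close> is finite. An index within \<open>e\<close>
  of the infimum stands in for a minimizer, and the error \<open>e * \<delta>\<close> is absorbed by
  \<open>e\<close>.\<close>

lemma ennreal_le_of_INF_affine:
  fixes W :: ennreal and f :: "'i \<Rightarrow> ennreal"
  assumes W: "W = (INF i \<in> I. f i)" "W < \<infinity>" and \<delta>: "0 \<le> \<delta>" "\<delta> < 1" and t: "0 \<le> t"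
    and le: "\<And>i. i \<in> I \<Longrightarrow> W \<le> f i * ennreal \<delta> + ennreal t"
  shows "W \<le> ennreal (t / (1 - \<delta>))"
proof -
  obtain w where w: "W = ennreal w" "w \<ge> 0"
    using W(2) by (cases W) auto
  have "(1 - \<delta>) * w \<le> t"
  proof (rule field_le_epsilon)
    fix e :: real assume e: "e > 0"
    have "(INF i \<in> I. f i) < ennreal (w + e)"
      using e w unfolding W(1)[symmetric] by (simp add: ennreal_less_iff)
    then obtain i where i: "i \<in> I" "f i < ennreal (w + e)" by (auto simp: INF_less_iff)
    have "ennreal w \<le> f i * ennreal \<delta> + ennreal t" using le[OF i(1)] w by simp
    also have "\<dots> \<le> ennreal (w + e) * ennreal \<delta> + ennreal t"
      using i(2) by (intro add_right_mono mult_right_mono) auto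
    also have "\<dots> = ennreal ((w + e) * \<delta> + t)"
      using w e \<delta> t by (simp add: ennreal_mult ennreal_plus)
    finally have "w \<le> (w + e) * \<delta> + t"
      using w e \<delta> t by (subst (asm) ennreal_le_iff) auto
    moreover have "e * \<delta> \<le> e" using e \<delta> by (simp add: mult_left_le)
    ultimately show "(1 - \<delta>) * w \<le> t + e" by (simp add: algebra_simps)
  qed
  then show ?thesis
    unfolding w using \<delta> by (intro ennreal_leI) (simp add: pos_le_divide_eq mult.commute)
qed

text \<open>For a fixed coupling \<kappa> of the data laws, the one-step bound is optimized over
  couplings of the stationary laws and solved for the distance; only then is the infimum over
  \<kappa> taken.\<close>

lemma wasserstein_stationary_le:
  fixes \<pi> \<pi>' :: "(real^'d) measure" and \<mu> \<mu>' :: "((real^'d^'d) \<times> (real^'d)) measure"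
  assumes \<pi>: "prob_space \<pi>" "sets \<pi> = sets borel" and \<pi>': "prob_space \<pi>'" "sets \<pi>' = sets borel"
    and \<mu>: "prob_space \<mu>" "sets \<mu> = sets borel"
    and \<eta>: "\<eta> > 0"
    and inv: "distr (\<pi> \<Otimes>\<^sub>M \<mu>) borel (\<lambda>(x, z). affine_step \<eta> z x) = \<pi>"
    and inv': "distr (\<pi>' \<Otimes>\<^sub>M \<mu>') borel (\<lambda>(x, z). affine_step \<eta> z x) = \<pi>'"
    and \<delta>: "(\<integral>\<^sup>+z. ennreal (spectral_norm (mat 1 - \<eta> *\<^sub>R fst z)) \<partial>\<mu>) = ennreal \<delta>" "0 \<le> \<delta>" "\<delta> < 1"
    and fin: "(\<integral>\<^sup>+z. ennreal (norm (snd z)) \<partial>\<mu>) < \<infinity>"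
    and pq: "1 < p" "1 < q" and mom: "finite_moment q \<pi>'"
  shows "wasserstein 1 norm \<pi> \<pi>' \<le>
    ennreal (((\<integral>x. norm x powr q \<partial>\<pi>') powr (1 / q) + 1) * (\<eta> / (1 - \<delta>))) * wasserstein p pair_norm \<mu> \<mu>'"
proof -
  interpret \<pi>': prob_space \<pi>' by fact
  note [measurable_cong] = \<pi>(2) \<pi>'(2) \<mu>(2)
  \<comment> \<open>\<open>c\<close> is the q-norm of the second law and dominates its first moment.
    The extra 1 in \<open>c + 1\<close> will account for the error in the vector component.\<close>
  define c where "c = (\<integral>x. norm x powr q \<partial>\<pi>') powr (1 / q)"
  have c: "c \<ge> 0" by (simp add: c_def)
  have "(\<integral>\<^sup>+x. ennreal (norm x) \<partial>\<pi>') \<le> ennreal_root q (\<integral>\<^sup>+x. ennreal (norm x powr q) \<partial>\<pi>')"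
    by (rule \<pi>'.nn_integral_le_ennreal_root) (use pq in auto)
  also have "(\<integral>\<^sup>+x. ennreal (norm x powr q) \<partial>\<pi>') = ennreal (\<integral>x. norm x powr q \<partial>\<pi>')"
    using mom by (intro nn_integral_eq_integral) (auto simp: finite_moment_def)
  finally have m': "(\<integral>\<^sup>+x. ennreal (norm x) \<partial>\<pi>') \<le> ennreal c"
    by (simp add: ennreal_root_def c_def integral_nonneg)
  define W where "W = wasserstein 1 norm \<pi> \<pi>'"
  have m: "(\<integral>\<^sup>+x. ennreal (norm x) \<partial>\<pi>) < \<infinity>"
    by (rule stationary_first_moment_finite[OF \<pi> \<mu> _ inv \<delta> fin]) (use \<eta> in simp)
  have Wfin: "W < \<infinity>"
    unfolding W_def by (rule wasserstein_1_finite[OF \<pi> \<pi>' m]) (use m' in \<open>simp add: le_less_trans\<close>)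
  have W: "W = (INF \<gamma> \<in> couplings \<pi> \<pi>'. \<integral>\<^sup>+w. ennreal (norm (fst w - snd w)) \<partial>\<gamma>)"
    by (simp add: W_def wasserstein_def)
  define K where "K = (c + 1) * (\<eta> / (1 - \<delta>))"
  have K: "K > 0" using c \<eta> \<delta> by (simp add: K_def)
  \<comment> \<open>Dividing by \<open>K\<close> leaves a bare infimum over \<kappa> on the right,
    so it suffices to bound each cost from below. Multiplication by the positive finite
    \<open>K\<close> recovers the claim.\<close>
  have "ennreal (1 / K) * W \<le> wasserstein p pair_norm \<mu> \<mu>'"
    unfolding wasserstein_def
  proof (rule INF_greatest)
    fix \<kappa> assume \<kappa>: "\<kappa> \<in> couplings \<mu> \<mu>'"
    define R where "R = ennreal_root p (\<integral>\<^sup>+v. ennreal (pair_norm (fst v - snd v) powr p) \<partial>\<kappa>)"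
    have \<kappa>': "prob_space \<kappa>" "sets \<kappa> = sets (borel \<Otimes>\<^sub>M borel)" using \<kappa> by (auto simp: couplings_def)
    have R1: "(\<integral>\<^sup>+v. ennreal (spectral_norm (fst (fst v - snd v))) \<partial>\<kappa>) \<le> R"
      unfolding R_def
      by (rule nn_integral_le_wasserstein_cost[where f = "\<lambda>z. spectral_norm (fst z)"])
        (use \<kappa>' pq spectral_norm_le_pair_norm in auto)
    have R2: "(\<integral>\<^sup>+v. ennreal (norm (snd (fst v - snd v))) \<partial>\<kappa>) \<le> R"
      unfolding R_def
      by (rule nn_integral_le_wasserstein_cost[where f = "\<lambda>z. norm (snd z)"])
        (use \<kappa>' pq norm_le_pair_norm in auto)
    show "ennreal (1 / K) * W \<le> R"
    \<comment> \<open>A coupling of infinite cost gives nothing to prove.\<close>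
    proof (cases R)
      case (real r)
      have "W \<le> (\<integral>\<^sup>+w. ennreal (norm (fst w - snd w)) \<partial>\<gamma>) * ennreal \<delta> + ennreal (\<eta> * (c + 1) * r)"
        if \<gamma>: "\<gamma> \<in> couplings \<pi> \<pi>'" for \<gamma>
      proof -
        have "W \<le> (\<integral>\<^sup>+w. ennreal (norm (fst w - snd w)) \<partial>\<gamma>) * ennreal \<delta> +
          ennreal \<eta> * ((\<integral>\<^sup>+x. ennreal (norm x) \<partial>\<pi>') * (\<integral>\<^sup>+v. ennreal (spectral_norm (fst (fst v - snd v))) \<partial>\<kappa>) +
            (\<integral>\<^sup>+v. ennreal (norm (snd (fst v - snd v))) \<partial>\<kappa>))"
          using wasserstein_affine_step_le[OF \<gamma> \<kappa> _ inv inv'] \<eta> by (simp add: \<delta> W_def)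
        also have "\<dots> \<le> (\<integral>\<^sup>+w. ennreal (norm (fst w - snd w)) \<partial>\<gamma>) * ennreal \<delta> +
          ennreal \<eta> * (ennreal c * R + R)"
          by (intro add_left_mono mult_left_mono add_mono mult_mono m' R1 R2) auto
        also have "ennreal \<eta> * (ennreal c * R + R) = ennreal (\<eta> * (c + 1) * r)"
          using real c \<eta> by (simp add: ennreal_mult[symmetric] ennreal_plus[symmetric] algebra_simps del: ennreal_plus)
        finally show ?thesis .
      qed
      then have "W \<le> ennreal (\<eta> * (c + 1) * r / (1 - \<delta>))"
        by (intro ennreal_le_of_INF_affine[OF W Wfin]) (use \<delta> \<eta> c real in auto)
      also have "\<eta> * (c + 1) * r / (1 - \<delta>) = K * r" by (simp add: K_def)
      finally have "ennreal (1 / K) * W \<le> ennreal (1 / K) * ennreal (K * r)"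
        by (rule mult_left_mono) simp
      also have "\<dots> = R" using K real by (simp add: ennreal_mult[symmetric])
      finally show ?thesis .
    qed simp
  qed
  then have "ennreal K * (ennreal (1 / K) * W) \<le> ennreal K * wasserstein p pair_norm \<mu> \<mu>'"
    by (rule mult_left_mono) simp
  also have "ennreal K * (ennreal (1 / K) * W) = W"
    using K by (simp add: mult.assoc[symmetric] ennreal_mult[symmetric])
  finally show ?thesis by (simp add: W_def K_def c_def)
qed

section \<open>Batches\<close>

lemma batch_pair_measurable:
  assumes "\<And>i. i \<in> S \<Longrightarrow> a i \<in> borel_measurable M" "\<And>i. i \<in> S \<Longrightarrow> y i \<in> borel_measurable M"
  shows "(\<lambda>\<omega>. batch_pair b (\<lambda>i. a i \<omega> :: real^'d) (\<lambda>i. y i \<omega>) S) \<in> borel_measurable M"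
proof -
  have "continuous_on UNIV (outer_square :: real^'d \<Rightarrow> _)"
    unfolding outer_square_def by (intro continuous_intros)
  then have o: "(outer_square :: real^'d \<Rightarrow> _) \<in> borel_measurable borel"
    by (rule borel_measurable_continuous_onI)
  have "(\<lambda>\<omega>. batch_matrix b (\<lambda>i. a i \<omega>) S) \<in> borel_measurable M"
    unfolding batch_matrix_def
    by (intro borel_measurable_scaleR borel_measurable_const borel_measurable_sum measurable_compose[OF _ o] assms)
  moreover have "(\<lambda>\<omega>. batch_vector b (\<lambda>i. a i \<omega>) (\<lambda>i. y i \<omega>) S) \<in> borel_measurable M"
    unfolding batch_vector_def
    by (intro borel_measurable_scaleR borel_measurable_const borel_measurable_sum assms)
  ultimately show ?thesis unfolding batch_pair_def by (rule borel_measurable_Pair)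
qed

section \<open>Transition kernels as laws of affine steps\<close>

lemma sgd_1: "sgd \<eta> b a y Om x 1 = affine_step \<eta> (batch_pair b a y (Om 1)) x"
  by (simp add: affine_step_def batch_pair_def)

lemma affine_step_measurable_left: "(\<lambda>z. affine_step \<eta> z x) \<in> borel \<rightarrow>\<^sub>M borel"
  using measurable_Pair2[OF affine_step_measurable, of x \<eta>] by simp

text \<open>The first online batch is \<open>{b * (1 - 1) + 1 .. b * 1} = {1..b}\<close>, exactly
  the batch that defines the population law.\<close>

lemma online_kernel_eq:
  assumes "\<And>i. 1 \<le> i \<Longrightarrow> a i \<in> borel_measurable M" "\<And>i. 1 \<le> i \<Longrightarrow> y i \<in> borel_measurable M"
  shows "online_kernel \<eta> b M a y x = distr (population_law b M a y) borel (\<lambda>z. affine_step \<eta> z x)"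
proof -
  have "(\<lambda>\<omega>. batch_pair b (\<lambda>i. a i \<omega>) (\<lambda>i. y i \<omega>) {1..b}) \<in> borel_measurable M"
    by (rule batch_pair_measurable) (use assms in auto)
  then show ?thesis
    unfolding online_kernel_def population_law_def sgd_1
    by (subst distr_distr[OF affine_step_measurable_left]) (auto simp: comp_def online_batch_def)
qed

text \<open>The first batch is uniform on \<open>batches n b\<close>, and the empirical law is the
  image of that uniform law. Measurability in the batch is automatic because every subset of
  \<open>batches n b\<close> is measurable.\<close>

lemma offline_kernel_eq:
  assumes Om: "Om 1 \<in> N \<rightarrow>\<^sub>M count_space (batches n b)"
    and uniform: "distr N (count_space (batches n b)) (Om 1) = uniform_count_measure (batches n b)"
  shows "offline_kernel \<eta> b a y N Om x = distr (empirical_law n b a y) borel (\<lambda>z. affine_step \<eta> z x)"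
proof -
  have "offline_kernel \<eta> b a y N Om x =
      distr (distr N (count_space (batches n b)) (Om 1)) borel (\<lambda>S. affine_step \<eta> (batch_pair b a y S) x)"
    unfolding offline_kernel_def sgd_1
    by (subst distr_distr[OF _ Om]) (simp_all add: comp_def)
  also have "\<dots> = distr (empirical_law n b a y) borel (\<lambda>z. affine_step \<eta> z x)"
    unfolding uniform empirical_law_def
    by (subst distr_distr[OF affine_step_measurable_left])
      (auto simp: comp_def measurable_def sets_uniform_count_measure space_uniform_count_measure)
  finally show ?thesis .
qed

text \<open>The trace of the batch matrix is the sum of the squared norms of the \<open>a i\<close>
  divided by \<open>b\<close>, and each diagonal entry is at most the spectral norm. Integrability
  of the batch vector thus reduces to second moments of \<open>y\<close> and to the spectral norm of
  the matrix.\<close>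

lemma norm_batch_vector_le:
  fixes a :: "nat \<Rightarrow> real^'d"
  assumes b: "1 \<le> b"
  shows "norm (batch_vector b a y S) \<le>
    (\<Sum>i\<in>S. (y i)\<^sup>2) + real CARD('d) * (real b * spectral_norm (batch_matrix b a S))"
proof -
  have "norm (batch_vector b a y S) = (1 / real b) * norm (\<Sum>i\<in>S. y i *\<^sub>R a i)"
    by (simp add: batch_vector_def)
  also have "\<dots> \<le> 1 * norm (\<Sum>i\<in>S. y i *\<^sub>R a i)"
    using b by (intro mult_right_mono) auto
  also have "\<dots> \<le> (\<Sum>i\<in>S. \<bar>y i\<bar> * norm (a i))"
    by (simp add: sum_norm_le)
  also have "\<dots> \<le> (\<Sum>i\<in>S. (y i)\<^sup>2 + (norm (a i))\<^sup>2)"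
  proof (rule sum_mono)
    fix i
    have "2 * (\<bar>y i\<bar> * norm (a i)) \<le> (y i)\<^sup>2 + (norm (a i))\<^sup>2"
      using sum_squares_bound[of "\<bar>y i\<bar>" "norm (a i)"] by (simp add: mult.assoc)
    then show "\<bar>y i\<bar> * norm (a i) \<le> (y i)\<^sup>2 + (norm (a i))\<^sup>2"
      using mult_nonneg_nonneg[OF abs_ge_zero[of "y i"] norm_ge_zero[of "a i"]] by linarith
  qed
  also have "\<dots> = (\<Sum>i\<in>S. (y i)\<^sup>2) + (\<Sum>i\<in>S. \<Sum>k\<in>UNIV. (a i $ k)\<^sup>2)"
    unfolding power2_norm_eq_inner inner_vec_def by (simp add: sum.distrib power2_eq_square)
  also have "(\<Sum>i\<in>S. \<Sum>k\<in>UNIV. (a i $ k)\<^sup>2) = (\<Sum>k\<in>UNIV. \<Sum>i\<in>S. (a i $ k)\<^sup>2)"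
    by (rule sum.swap)
  also have "\<dots> = (\<Sum>k\<in>UNIV. real b * batch_matrix b a S $ k $ k)"
    using b by (simp add: batch_matrix_def outer_square_def power2_eq_square)
  also have "\<dots> \<le> (\<Sum>k\<in>(UNIV :: 'd set). real b * spectral_norm (batch_matrix b a S))"
    by (intro sum_mono mult_left_mono order_trans[OF abs_ge_self component_le_spectral_norm]) simp
  finally show ?thesis by simp
qed

lemma spectral_norm_mat_1: "spectral_norm (mat 1 :: real^'d^'d) \<le> 1"
  unfolding spectral_norm_def by (rule onorm_le) simp

section \<open>The bound for the online and offline stationary laws\<close>

theorem theorem4:
  fixes M :: "'w measure" and N :: "'s measure"
    and a :: "nat \<Rightarrow> 'w \<Rightarrow> real^'d" and y :: "nat \<Rightarrow> 'w \<Rightarrow> real"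
    and b n :: nat and \<eta> \<sigma> \<alpha> p q \<delta>\<^sub>A \<epsilon> :: real
    and A\<^sub>1 :: "'w \<Rightarrow> real^'d^'d"
    and \<pi> :: "(real^'d) measure"
    and Om :: "nat \<Rightarrow> 's \<Rightarrow> nat set" and X\<^sub>0 :: "'w \<Rightarrow> 's \<Rightarrow> real^'d"
    and ergodic :: "'w \<Rightarrow> (real^'d) measure \<Rightarrow> bool"
  assumes M: "prob_space M" and b: "b \<ge> 1" and \<eta>: "\<eta> > 0"
    and indep: "prob_space.indep_vars M (\<lambda>_. borel) (\<lambda>i \<omega>. (a i \<omega>, y i \<omega>)) {1..}"
    and ident: "\<And>i. i \<ge> 1 \<Longrightarrow>
      distr M borel (\<lambda>\<omega>. (a i \<omega>, y i \<omega>)) = distr M borel (\<lambda>\<omega>. (a 1 \<omega>, y 1 \<omega>))"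
    and \<sigma>: "\<sigma> > 0"
    and gauss: "distributed M lborel (a 1)
      (\<lambda>x. ennreal (\<Prod>i\<in>UNIV. normal_density 0 \<sigma> (x $ i)))"
    and density: "\<exists>f. continuous_on UNIV f \<and> (\<forall>t. f t \<ge> 0) \<and>
      distributed M lborel (y 1) (\<lambda>t. ennreal (f t))"
    and moments: "\<And>k::nat. integrable M (\<lambda>\<omega>. \<bar>y 1 \<omega>\<bar> ^ k)"
    and A\<^sub>1: "\<And>\<omega>. A\<^sub>1 \<omega> = batch_matrix b (\<lambda>i. a i \<omega>) {1..b}"
    and log_contr: "(\<integral>\<omega>. ln (spectral_norm (mat 1 - \<eta> *\<^sub>R A\<^sub>1 \<omega>)) \<partial>M) < 0"
    and \<alpha>: "\<alpha> > 0" "(\<integral>\<omega>. spectral_norm (mat 1 - \<eta> *\<^sub>R A\<^sub>1 \<omega>) powr \<alpha> \<partial>M) = 1"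
    and \<alpha>_gt_1: "\<alpha> > 1" and \<alpha>_nonint: "\<alpha> \<notin> \<nat>"
    and \<pi>: "stationary_distribution (online_kernel \<eta> b M a y) \<pi>"
    and \<delta>\<^sub>A: "\<delta>\<^sub>A = (\<integral>\<omega>. spectral_norm (mat 1 - \<eta> *\<^sub>R A\<^sub>1 \<omega>) \<partial>M)"
    and pq: "p > 0" "q > 0" "1 / p + 1 / q = 1"
    and p: "p > real CARD('d) / 2" and q: "q < \<alpha>"
    (* the offline chain, given the data set of \<omega>, with initial state X\<^sub>0 \<omega> *)
    and n: "n \<ge> 1" "n \<ge> b" and N: "prob_space N"
    and Om_indep: "prob_space.indep_vars N (\<lambda>_. count_space (batches n b)) Om {1..}"
    and Om_uniform: "\<And>k. k \<ge> 1 \<Longrightarrow>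
      distr N (count_space (batches n b)) (Om k) = uniform_count_measure (batches n b)"
    and X\<^sub>0: "\<And>\<omega>. \<omega> \<in> space M \<Longrightarrow> indep_of_each_other N
      borel (X\<^sub>0 \<omega>) (Pi\<^sub>M {1..} (\<lambda>_. count_space (batches n b))) (\<lambda>s. \<lambda>k\<in>{1..}. Om k s)"
    and ergodic: "\<And>\<omega> \<nu>. ergodic \<omega> \<nu> \<longleftrightarrow>
      offline_ergodic_with \<eta> b (\<lambda>i. a i \<omega>) (\<lambda>i. y i \<omega>) N Om (X\<^sub>0 \<omega>) \<nu> \<and> finite_moment q \<nu>"
    (* outer probability, which is the probability if the set is an event *)
    and \<epsilon>: "\<epsilon> = enn2real (outer_measure_of M {\<omega> \<in> space M. \<not> (\<exists>\<nu>. ergodic \<omega> \<nu>)})"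
  shows "\<exists>E \<in> sets M. measure M E \<ge> 1 - \<epsilon> \<and>
    (\<forall>\<omega>\<in>E. (\<exists>\<nu>. ergodic \<omega> \<nu>) \<and>
      (\<forall>\<pi>\<^sub>n. ergodic \<omega> \<pi>\<^sub>n \<longrightarrow>
        (let c\<^sub>0 = (\<integral>x. norm x powr q \<partial>\<pi>\<^sub>n) powr (1 / q) + 1
         in wasserstein 1 norm \<pi> \<pi>\<^sub>n \<le>
           ennreal (c\<^sub>0 * (\<eta> / (1 - \<delta>\<^sub>A))) *
           wasserstein p pair_norm (population_law b M a y)
             (empirical_law n b (\<lambda>i. a i \<omega>) (\<lambda>i. y i \<omega>)))))"
proof -
  interpret M: prob_space M by fact
  interpret N: prob_space N by fact
  have rv: "(\<lambda>\<omega>. (a i \<omega>, y i \<omega>)) \<in> M \<rightarrow>\<^sub>M borel" if "1 \<le> i" for i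
    using indep that by (auto simp: M.indep_vars_def2)
  have a_meas: "a i \<in> borel_measurable M" if "1 \<le> i" for i
    using measurable_compose[OF rv[OF that], of fst borel] borel_measurable_continuous_onI[OF continuous_on_fst[OF continuous_on_id]]
    by simp
  have y_meas: "y i \<in> borel_measurable M" if "1 \<le> i" for i
    using measurable_compose[OF rv[OF that], of snd borel] borel_measurable_continuous_onI[OF continuous_on_snd[OF continuous_on_id]]
    by simp
  define \<mu> where "\<mu> = population_law b M a y"
  define pair where "pair = (\<lambda>\<omega>. batch_pair b (\<lambda>i. a i \<omega>) (\<lambda>i. y i \<omega>) {1..b})"
  have pair: "pair \<in> borel_measurable M"
    unfolding pair_def by (rule batch_pair_measurable) (use a_meas y_meas in auto)
  have \<mu>_distr: "\<mu> = distr M borel pair" by (simp add: \<mu>_def population_law_def pair_def)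
  have \<mu>: "prob_space \<mu>" "sets \<mu> = sets borel"
    using M.prob_space_distr[OF pair] by (auto simp: \<mu>_distr)
  have fst_pair: "fst (pair \<omega>) = A\<^sub>1 \<omega>" for \<omega> by (simp add: pair_def batch_pair_def A\<^sub>1)
  have m_fst: "(\<lambda>z :: (real^'d^'d) \<times> (real^'d). spectral_norm (mat 1 - \<eta> *\<^sub>R fst z)) \<in> borel_measurable borel"
    by (intro borel_measurable_continuous_onI continuous_on_compose2[OF continuous_on_spectral_norm] continuous_intros) auto
  have m_snd: "(\<lambda>z :: (real^'d^'d) \<times> (real^'d). norm (snd z)) \<in> borel_measurable borel"
    by (intro borel_measurable_continuous_onI continuous_intros)
  define f where "f = (\<lambda>\<omega>. spectral_norm (mat 1 - \<eta> *\<^sub>R A\<^sub>1 \<omega>))"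
  have f_meas: "f \<in> borel_measurable M"
    using measurable_compose[OF pair m_fst] by (simp add: f_def fst_pair)
  have f_nonneg: "0 \<le> f \<omega>" for \<omega> by (simp add: f_def)
  \<comment> \<open>Strict Jensen with exponent \<alpha>: a negative mean logarithm excludes that
    \<open>f\<close> is 1 almost everywhere.\<close>
  have f_int: "integrable M f" and \<delta>1: "\<delta>\<^sub>A < 1"
    using M.expectation_less_1[OF f_meas f_nonneg \<alpha>_gt_1] \<alpha>(2) log_contr by (simp_all add: f_def \<delta>\<^sub>A)
  have \<delta>0: "0 \<le> \<delta>\<^sub>A" by (simp add: \<delta>\<^sub>A integral_nonneg)
  have \<delta>: "(\<integral>\<^sup>+z. ennreal (spectral_norm (mat 1 - \<eta> *\<^sub>R fst z)) \<partial>\<mu>) = ennreal \<delta>\<^sub>A"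
  proof -
    have "(\<integral>\<^sup>+z. ennreal (spectral_norm (mat 1 - \<eta> *\<^sub>R fst z)) \<partial>\<mu>) = (\<integral>\<^sup>+\<omega>. ennreal (f \<omega>) \<partial>M)"
      unfolding \<mu>_distr using m_fst by (subst nn_integral_distr[OF pair]) (auto simp: f_def fst_pair)
    also have "\<dots> = ennreal \<delta>\<^sub>A"
      using f_nonneg by (subst nn_integral_eq_integral[OF f_int]) (auto simp: \<delta>\<^sub>A f_def)
    finally show ?thesis .
  qed
  \<comment> \<open>The second moment of \<open>y 1\<close> carries over to every index through the
    common law of the pairs.\<close>
  have y_sq: "integrable M (\<lambda>\<omega>. (y i \<omega>)\<^sup>2)" if "1 \<le> i" for i
  proof -
    have sq: "(\<lambda>z :: (real^'d) \<times> real. (snd z)\<^sup>2) \<in> borel_measurable borel"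
      by (intro borel_measurable_continuous_onI continuous_intros)
    have "integrable (distr M borel (\<lambda>\<omega>. (a 1 \<omega>, y 1 \<omega>))) (\<lambda>z. (snd z)\<^sup>2)"
      using moments[of 2] by (subst integrable_distr_eq[OF rv sq]) auto
    then show ?thesis
      unfolding ident[OF that, symmetric] by (subst (asm) integrable_distr_eq[OF rv[OF that] sq]) simp
  qed
  have fin: "(\<integral>\<^sup>+z. ennreal (norm (snd z)) \<partial>\<mu>) < \<infinity>"
  proof -
    \<comment> \<open>\<open>g\<close> dominates the batch vector: its trace bound involves
      \<open>spectral_norm (A\<^sub>1 \<omega>)\<close>, and the triangle inequality with the
      identity matrix gives \<open>\<eta> * spectral_norm (A\<^sub>1 \<omega>) \<le> f \<omega> +
      1\<close>.\<close>
    define g where "g = (\<lambda>\<omega>. (\<Sum>i=1..b. (y i \<omega>)\<^sup>2) + real CARD('d) * (real b * ((f \<omega> + 1) / \<eta>)))"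
    have g_int: "integrable M g"
      unfolding g_def using f_int y_sq by (auto intro!: Bochner_Integration.integrable_add)
    have le: "norm (snd (pair \<omega>)) \<le> g \<omega>" for \<omega>
    proof -
      have "\<eta> * spectral_norm (A\<^sub>1 \<omega>) \<le> f \<omega> + 1"
        using spectral_norm_triangle[of "\<eta> *\<^sub>R A\<^sub>1 \<omega> - mat 1" "mat 1"] spectral_norm_mat_1[where 'd = 'd] \<eta>
          spectral_norm_minus_commute[of "mat 1" "\<eta> *\<^sub>R A\<^sub>1 \<omega>"]
        by (simp add: f_def spectral_norm_scaleR)
      then have "spectral_norm (A\<^sub>1 \<omega>) \<le> (f \<omega> + 1) / \<eta>"
        using \<eta> by (simp add: pos_le_divide_eq mult.commute)
      then have "real CARD('d) * (real b * spectral_norm (A\<^sub>1 \<omega>)) \<le> real CARD('d) * (real b * ((f \<omega> + 1) / \<eta>))"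
        by (intro mult_left_mono) auto
      then show ?thesis
        using norm_batch_vector_le[OF b, of "\<lambda>i. a i \<omega>" "\<lambda>i. y i \<omega>" "{1..b}"]
        by (simp add: pair_def batch_pair_def g_def A\<^sub>1)
    qed
    have "(\<integral>\<^sup>+z. ennreal (norm (snd z)) \<partial>\<mu>) = (\<integral>\<^sup>+\<omega>. ennreal (norm (snd (pair \<omega>))) \<partial>M)"
      unfolding \<mu>_distr using m_snd by (subst nn_integral_distr[OF pair]) auto
    also have "\<dots> \<le> (\<integral>\<^sup>+\<omega>. ennreal (g \<omega>) \<partial>M)"
      by (intro nn_integral_mono ennreal_leI le)
    also have "\<dots> = ennreal (\<integral>\<omega>. g \<omega> \<partial>M)"
      by (rule nn_integral_eq_integral[OF g_int]) (use le order_trans[OF norm_ge_zero] in blast)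
    finally show ?thesis by (rule le_less_trans) simp
  qed
  have "1 / p > 0" "1 / q > 0" using pq by simp_all
  with pq(3) have "1 / p < 1" "1 / q < 1" by linarith+
  with pq have p1: "1 < p" and q1: "1 < q" by (simp_all add: divide_less_eq_1)
  have \<pi>': "prob_space \<pi>" "sets \<pi> = sets borel"
    using \<pi> by (auto simp: stationary_distribution_def)
  have inv: "distr (\<pi> \<Otimes>\<^sub>M \<mu>) borel (\<lambda>(x, z). affine_step \<eta> z x) = \<pi>"
    by (rule stationary_affine_step[OF \<pi> _ \<mu>]) (simp add: \<mu>_def online_kernel_eq a_meas y_meas)
  have Om1: "Om 1 \<in> N \<rightarrow>\<^sub>M count_space (batches n b)"
    using Om_indep by (auto simp: N.indep_vars_def2)
  \<comment> \<open>For a fixed data set the bound is deterministic: it holds for each \<omega> and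
    each law satisfying \<open>ergodic\<close>. Probability over the data enters only through the
    event on which such a law exists.\<close>
  have bound: "wasserstein 1 norm \<pi> \<pi>\<^sub>n \<le>
      ennreal (((\<integral>x. norm x powr q \<partial>\<pi>\<^sub>n) powr (1 / q) + 1) * (\<eta> / (1 - \<delta>\<^sub>A))) *
      wasserstein p pair_norm (population_law b M a y) (empirical_law n b (\<lambda>i. a i \<omega>) (\<lambda>i. y i \<omega>))"
    if erg: "ergodic \<omega> \<pi>\<^sub>n" for \<omega> \<pi>\<^sub>n
  proof -
    let ?\<mu> = "empirical_law n b (\<lambda>i. a i \<omega>) (\<lambda>i. y i \<omega>)"
    have st: "stationary_distribution (offline_kernel \<eta> b (\<lambda>i. a i \<omega>) (\<lambda>i. y i \<omega>) N Om) \<pi>\<^sub>n"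
      and mom: "finite_moment q \<pi>\<^sub>n"
      using erg by (auto simp: ergodic offline_ergodic_with_def W1_ergodic_with_def)
    have \<pi>n: "prob_space \<pi>\<^sub>n" "sets \<pi>\<^sub>n = sets borel" using st by (auto simp: stationary_distribution_def)
    \<comment> \<open>As the law of the first batch, the uniform measure has total mass 1; no
      counting of batches is involved.\<close>
    have "prob_space (uniform_count_measure (batches n b))"
      unfolding Om_uniform[OF order_refl, symmetric] by (rule N.prob_space_distr[OF Om1])
    then have \<mu>n: "prob_space ?\<mu>" "sets ?\<mu> = sets borel"
      unfolding empirical_law_def
      by (auto intro!: prob_space.prob_space_distr simp: measurable_def sets_uniform_count_measure space_uniform_count_measure)
    have inv': "distr (\<pi>\<^sub>n \<Otimes>\<^sub>M ?\<mu>) borel (\<lambda>(x, z). affine_step \<eta> z x) = \<pi>\<^sub>n"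
      by (rule stationary_affine_step[OF st _ \<mu>n])
        (rule offline_kernel_eq[where Om = Om, OF Om1 Om_uniform[OF order_refl]])
    show ?thesis
      unfolding \<mu>_def[symmetric]
      by (rule wasserstein_stationary_le[OF \<pi>' \<pi>n \<mu> \<eta> inv inv' \<delta> \<delta>0 \<delta>1 fin p1 q1 mom])
  qed
  let ?bad = "{\<omega> \<in> space M. \<not> (\<exists>\<nu>. ergodic \<omega> \<nu>)}"
  \<comment> \<open>The bad set may fail to be an event. \<open>H\<close> is a measurable hull of
    the same outer measure, so its complement is an event of probability
    \<open>1 - \<epsilon>\<close> that avoids the bad set.\<close>
  obtain H where H: "H \<in> sets M" "?bad \<subseteq> H" "outer_measure_of M ?bad = emeasure M H"
    using outer_measure_of_attain[of ?bad M] by auto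
  show ?thesis
  proof (intro bexI[of _ "space M - H"] conjI ballI)
    show "1 - \<epsilon> \<le> measure M (space M - H)"
      using M.prob_compl[OF H(1)] unfolding \<epsilon> H(3) measure_def by simp
    show "space M - H \<in> sets M" using H(1) by auto
    show "\<exists>\<nu>. ergodic \<omega> \<nu>" if "\<omega> \<in> space M - H" for \<omega>
      using that H(2) by auto
    show "\<forall>\<pi>\<^sub>n. ergodic \<omega> \<pi>\<^sub>n \<longrightarrow> (let c\<^sub>0 = (\<integral>x. norm x powr q \<partial>\<pi>\<^sub>n) powr (1 / q) + 1
        in wasserstein 1 norm \<pi> \<pi>\<^sub>n \<le> ennreal (c\<^sub>0 * (\<eta> / (1 - \<delta>\<^sub>A))) *
          wasserstein p pair_norm (population_law b M a y)
            (empirical_law n b (\<lambda>i. a i \<omega>) (\<lambda>i. y i \<omega>)))" for \<omega>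
      unfolding Let_def using bound by blast
  qed
qed

end
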